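(* Let $G\rightrightarrows M$ be a Lie groupoid with source $\alpha$, target $\beta$, inversion $i$ and identity section $\epsilon$, let $L:G\to\mathbb{R}$ be a discrete Lagrangian on $G$ (a smooth function), and let $S_L=dL(G)\subseteq T^*G$, regarded as an implicit difference equation on the cotangent groupoid $T^*G\rightrightarrows A^*G$ with source $\tilde\alpha$ and target $\tilde\beta$. Then the first step $(S_L)^1_f=S_L\cap\tilde\beta^{-1}(\tilde\alpha(S_L))$ of the forward integrability algorithm applied to $S_L$ consists of the points $dL(g)\in S_L$ such that there exists an element $h\in G$ satisfying $(g,h)\in G_2$ and such that $(g,h)$ is a solution of the discrete Euler–Lagrange equations, that is, $$d\left[L\circ l_g+L\circ r_h\circ i\right](\epsilon(x))_{|A_xG}=0,\qquad x=\beta(g)=\alpha(h).$$ As a consequence, $$\{(g,h)\in G_2 : (g,h)\text{ is a solution of the discrete Euler–Lagrange equations}\}=\{(g,h)\in G_2 : \tilde\beta(dL(g))=\tilde\alpha(dL(h))\},$$ and $(S_L)^1_f$ is the set of the points $dL(g)$ for which there is $h\in G$ with $(g,h)$ in this set.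
   Context: For a Lie groupoid $G\rightrightarrows M$, $G_2=\{(g,h)\in G\times G:\beta(g)=\alpha(h)\}$ is the set of composable pairs. Left and right translations are $l_g:\alpha^{-1}(\beta(g))\to\alpha^{-1}(\alpha(g))$, $l_g(h)=gh$, and $r_g:\beta^{-1}(\alpha(g))\to\beta^{-1}(\beta(g))$, $r_g(h)=hg$. The Lie algebroid $AG\to M$ has fibre $A_xG=\ker(T_{\epsilon(x)}\alpha)$ at $x\in M$; $A^*G$ is the dual bundle. The function $L\circ l_g+L\circ r_h\circ i$ is defined on the $\alpha$-fibre $\alpha^{-1}(x)$, whose tangent space at $\epsilon(x)$ is $A_xG$. The cotangent groupoid $T^*G\rightrightarrows A^*G$ has target and source $$\tilde\beta(\mu_g)(X)=\mu_g\big((T_{\epsilon(\beta(g))}l_g)(X)\big),\quad \mu_g\in T^*_gG,\ X\in A_{\beta(g)}G,$$ $$\tilde\alpha(\nu_h)(Y)=\nu_h\big((T_{\epsilon(\alpha(h))}r_h)(Y-(T_{\epsilon(\alpha(h))}(\epsilon\circ\beta))(Y))\big),\quad \nu_h\in T_h^*G,\ Y\in A_{\alpha(h)}G,$$ so $\tilde\beta(\mu_g)\in A^*_{\beta(g)}G$ and $\tilde\alpha(\nu_h)\in A^*_{\alpha(h)}G$. An implicit difference equation on a Lie groupoid is a submanifold $E$ of it. The first step of the forward integrability algorithm applied to $E$ in a groupoid with source $\alpha$ and target $\beta$ is the set $E^1_f=E\cap\beta^{-1}(\alpha(E))$. *)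

theory Defs
  imports "HOL-Analysis.Analysis"
begin

section \<open>Smooth maps between subsets of Euclidean spaces\<close>

text \<open>For open \<open>U\<close>: all derivatives of \<open>f\<close> up to order \<open>k\<close> exist and are continuous on \<open>U\<close>.\<close>

primrec Ck_on :: "nat \<Rightarrow> 'a::euclidean_space set \<Rightarrow> ('a \<Rightarrow> 'b::euclidean_space) \<Rightarrow> bool" where
  "Ck_on 0 U f \<longleftrightarrow> continuous_on U f"
| "Ck_on (Suc k) U f \<longleftrightarrow> f differentiable_on U \<and>
     (\<forall>v. Ck_on k U (\<lambda>x. frechet_derivative f (at x) v))"

text \<open>On an arbitrary subset, smoothness means local extendability to a smooth map on an open
  subset of the ambient space.\<close>

definition smooth_on :: "'a::euclidean_space set \<Rightarrow> ('a \<Rightarrow> 'b::euclidean_space) \<Rightarrow> bool" where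
  "smooth_on A f \<longleftrightarrow> (\<forall>x\<in>A. \<exists>U f'. open U \<and> x \<in> U \<and> (\<forall>y\<in>A \<inter> U. f' y = f y) \<and> (\<forall>k. Ck_on k U f'))"


section \<open>Manifolds\<close>

text \<open>The model space is a linear subspace \<open>V\<close> of a Euclidean space instead of the
  whole type \<open>'e\<close>: the types of class \<open>euclidean_space\<close> have positive dimension, whereas a manifold
  of dimension \<open>dim V = 0\<close> (for instance the base of a Lie group regarded as a Lie groupoid over
  a point) has to be admitted. A chart is a pair of its domain and its coordinate map.\<close>

type_synonym ('a, 'e) chart = "'a set \<times> ('a \<Rightarrow> 'e)"

record ('a, 'e) mfd =
  mfd_top :: "'a topology"
  mfd_model :: "'e set"
  mfd_atlas :: "('a, 'e) chart set"

abbreviation pts :: "('a, 'e) mfd \<Rightarrow> 'a set" where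
  "pts M \<equiv> topspace (mfd_top M)"

definition chart_inv :: "('a, 'e) chart \<Rightarrow> 'e \<Rightarrow> 'a" where
  "chart_inv c = inv_into (fst c) (snd c)"

definition charts_at :: "('a, 'e) mfd \<Rightarrow> 'a \<Rightarrow> ('a, 'e) chart set" where
  "charts_at M p = {c \<in> mfd_atlas M. p \<in> fst c}"

definition smooth_manifold :: "('a, 'e::euclidean_space) mfd \<Rightarrow> bool" where
  "smooth_manifold M \<longleftrightarrow>
     Hausdorff_space (mfd_top M) \<and> second_countable (mfd_top M) \<and>
     subspace (mfd_model M) \<and>
     (\<Union>c\<in>mfd_atlas M. fst c) = pts M \<and>
     (\<forall>c\<in>mfd_atlas M.
        openin (mfd_top M) (fst c) \<and>
        openin (top_of_set (mfd_model M)) (snd c ` fst c) \<and>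
        homeomorphic_map (subtopology (mfd_top M) (fst c)) (top_of_set (snd c ` fst c)) (snd c)) \<and>
     (\<forall>c\<in>mfd_atlas M. \<forall>d\<in>mfd_atlas M.
        smooth_on (snd c ` (fst c \<inter> fst d)) (snd d \<circ> chart_inv c))"

definition euclidean_mfd :: "('e::euclidean_space, 'e) mfd" where
  "euclidean_mfd = \<lparr>mfd_top = euclidean, mfd_model = UNIV, mfd_atlas = {(UNIV, id)}\<rparr>"

definition prod_mfd :: "('a, 'e) mfd \<Rightarrow> ('b, 'f) mfd \<Rightarrow> ('a \<times> 'b, 'e \<times> 'f) mfd" where
  "prod_mfd M N = \<lparr>mfd_top = prod_topology (mfd_top M) (mfd_top N),
     mfd_model = mfd_model M \<times> mfd_model N,
     mfd_atlas = {(fst c \<times> fst d, map_prod (snd c) (snd d)) | c d. c \<in> mfd_atlas M \<and> d \<in> mfd_atlas N}\<rparr>"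

text \<open>Smoothness of a map defined on a subset \<open>S\<close> of \<open>M\<close>. If \<open>S\<close> is an embedded
  submanifold, this is smoothness with respect to its submanifold structure.\<close>

definition smooth_map_on ::
    "('a, 'e::euclidean_space) mfd \<Rightarrow> 'a set \<Rightarrow> ('b, 'f::euclidean_space) mfd \<Rightarrow> ('a \<Rightarrow> 'b) \<Rightarrow> bool" where
  "smooth_map_on M S N F \<longleftrightarrow> S \<subseteq> pts M \<and> F ` S \<subseteq> pts N \<and>
     (\<forall>p\<in>S. \<exists>c\<in>charts_at M p. \<exists>d\<in>charts_at N (F p). \<exists>W.
        openin (mfd_top M) W \<and> p \<in> W \<and> W \<subseteq> fst c \<and> F ` (W \<inter> S) \<subseteq> fst d \<and>
        smooth_on (snd c ` (W \<inter> S)) (snd d \<circ> F \<circ> chart_inv c))"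

abbreviation smooth_map ::
    "('a, 'e::euclidean_space) mfd \<Rightarrow> ('b, 'f::euclidean_space) mfd \<Rightarrow> ('a \<Rightarrow> 'b) \<Rightarrow> bool" where
  "smooth_map M N F \<equiv> smooth_map_on M (pts M) N F"


section \<open>Tangent vectors and tangent maps\<close>

text \<open>A tangent vector is an equivalence class of curves \<open>\<gamma>\<close> with \<open>\<gamma> 0 = p\<close>, two curves
  being equivalent if they have the same derivative at \<open>0\<close> in every chart around \<open>p\<close>. The class is
  represented by the family of these derivatives, indexed by the charts and extended by \<open>0\<close> to
  the other indices, so that the linear structure of the tangent space is the pointwise one.\<close>

type_synonym ('a, 'e) tvec = "('a, 'e) chart \<Rightarrow> 'e"

text \<open>Continuous curves through \<open>p\<close> that run inside \<open>S\<close> and are differentiable at \<open>0\<close>; only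
  the germ at \<open>0\<close> matters. On an embedded submanifold \<open>S\<close> (all of \<open>M\<close>, or a fibre of a
  submersion) they have the same velocities as the smooth curves in \<open>S\<close>.\<close>

definition curve_at :: "('a, 'e::euclidean_space) mfd \<Rightarrow> 'a set \<Rightarrow> 'a \<Rightarrow> (real \<Rightarrow> 'a) \<Rightarrow> bool" where
  "curve_at M S p \<gamma> \<longleftrightarrow> \<gamma> 0 = p \<and>
     (\<exists>\<delta>>0. \<gamma> ` {-\<delta><..<\<delta>} \<subseteq> S \<and> continuous_map (top_of_set {-\<delta><..<\<delta>}) (mfd_top M) \<gamma>) \<and>
     (\<forall>c\<in>charts_at M p. (snd c \<circ> \<gamma>) differentiable (at 0))"

definition velocity :: "('a, 'e::euclidean_space) mfd \<Rightarrow> (real \<Rightarrow> 'a) \<Rightarrow> ('a, 'e) tvec" where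
  "velocity M \<gamma> = (\<lambda>c. if c \<in> charts_at M (\<gamma> 0) then vector_derivative (snd c \<circ> \<gamma>) (at 0) else 0)"

text \<open>Tangent space at \<open>p\<close> of a submanifold \<open>S\<close>, as a subspace of the tangent space at \<open>p\<close> of
  \<open>M\<close>.\<close>

definition tangent_space_on :: "('a, 'e::euclidean_space) mfd \<Rightarrow> 'a set \<Rightarrow> 'a \<Rightarrow> ('a, 'e) tvec set" where
  "tangent_space_on M S p = {velocity M \<gamma> | \<gamma>. curve_at M S p \<gamma>}"

abbreviation tangent_space :: "('a, 'e::euclidean_space) mfd \<Rightarrow> 'a \<Rightarrow> ('a, 'e) tvec set" where
  "tangent_space M p \<equiv> tangent_space_on M (pts M) p"

text \<open>Tangent map at \<open>p\<close> of a smooth map \<open>F\<close> from a submanifold \<open>S\<close> of \<open>M\<close> to \<open>N\<close>: it sends the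
  class of \<open>\<gamma>\<close> to the class of \<open>F \<circ> \<gamma>\<close>. It is meaningful for \<open>v \<in> tangent_space_on M S p\<close>, and
  values of \<open>F\<close> outside \<open>S\<close> are irrelevant.\<close>

definition tangent_map_on ::
    "('a, 'e::euclidean_space) mfd \<Rightarrow> 'a set \<Rightarrow> ('b, 'f::euclidean_space) mfd \<Rightarrow> ('a \<Rightarrow> 'b) \<Rightarrow>
     'a \<Rightarrow> ('a, 'e) tvec \<Rightarrow> ('b, 'f) tvec" where
  "tangent_map_on M S N F p v =
     (THE w. \<forall>\<gamma>. curve_at M S p \<gamma> \<and> velocity M \<gamma> = v \<longrightarrow> velocity N (F \<circ> \<gamma>) = w)"

abbreviation tangent_map ::
    "('a, 'e::euclidean_space) mfd \<Rightarrow> ('b, 'f::euclidean_space) mfd \<Rightarrow> ('a \<Rightarrow> 'b) \<Rightarrow>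
     'a \<Rightarrow> ('a, 'e) tvec \<Rightarrow> ('b, 'f) tvec" where
  "tangent_map M N F p v \<equiv> tangent_map_on M (pts M) N F p v"

text \<open>Differential at \<open>p\<close> of a real function on a submanifold \<open>S\<close>; evaluation in the chart
  \<open>(UNIV, id)\<close> identifies the tangent spaces of the real line with the real line.\<close>

definition differential_on ::
    "('a, 'e::euclidean_space) mfd \<Rightarrow> 'a set \<Rightarrow> ('a \<Rightarrow> real) \<Rightarrow> 'a \<Rightarrow> ('a, 'e) tvec \<Rightarrow> real" where
  "differential_on M S f p v = tangent_map_on M S euclidean_mfd f p v (UNIV, id)"

definition submersion ::
    "('a, 'e::euclidean_space) mfd \<Rightarrow> ('b, 'f::euclidean_space) mfd \<Rightarrow> ('a \<Rightarrow> 'b) \<Rightarrow> bool" where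
  "submersion M N F \<longleftrightarrow> smooth_map M N F \<and>
     (\<forall>p\<in>pts M. tangent_map M N F p ` tangent_space M p = tangent_space N (F p))"

text \<open>Linear functionals on a vector space of tangent vectors; they are \<open>extensional\<close>, so that
  equality of functionals is equality of functions.\<close>

definition dual_space :: "('a, 'e::euclidean_space) tvec set \<Rightarrow> (('a, 'e) tvec \<Rightarrow> real) set" where
  "dual_space T = {\<mu> \<in> extensional T.
     \<forall>u\<in>T. \<forall>v\<in>T. \<forall>a b. \<mu> (\<lambda>c. a *\<^sub>R u c + b *\<^sub>R v c) = a * \<mu> u + b * \<mu> v}"

definition cotangent_bundle ::
    "('a, 'e::euclidean_space) mfd \<Rightarrow> ('a \<times> (('a, 'e) tvec \<Rightarrow> real)) set" where
  "cotangent_bundle M = {(p, \<mu>). p \<in> pts M \<and> \<mu> \<in> dual_space (tangent_space M p)}"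

text \<open>The section \<open>dL\<close> of the cotangent bundle.\<close>

definition d_section ::
    "('a, 'e::euclidean_space) mfd \<Rightarrow> ('a \<Rightarrow> real) \<Rightarrow> 'a \<Rightarrow> 'a \<times> (('a, 'e) tvec \<Rightarrow> real)" where
  "d_section M L p = (p, \<lambda>v\<in>tangent_space M p. differential_on M (pts M) L p v)"


section \<open>Lie groupoids\<close>

record ('g, 'e, 'm, 'f) groupoid =
  arrows :: "('g, 'e) mfd"
  objects :: "('m, 'f) mfd"
  src :: "'g \<Rightarrow> 'm"
  tgt :: "'g \<Rightarrow> 'm"
  ident :: "'m \<Rightarrow> 'g"
  inver :: "'g \<Rightarrow> 'g"
  mult :: "'g \<Rightarrow> 'g \<Rightarrow> 'g"

definition composable :: "('g, 'e, 'm, 'f) groupoid \<Rightarrow> ('g \<times> 'g) set" where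
  "composable \<Gamma> = {(g, h). g \<in> pts (arrows \<Gamma>) \<and> h \<in> pts (arrows \<Gamma>) \<and> tgt \<Gamma> g = src \<Gamma> h}"

text \<open>Since source and target are submersions, the set of composable pairs is an embedded submanifold
  of the product manifold, which is the structure used for smoothness of the multiplication.\<close>

definition lie_groupoid :: "('g, 'e::euclidean_space, 'm, 'f::euclidean_space) groupoid \<Rightarrow> bool" where
  "lie_groupoid \<Gamma> \<longleftrightarrow>
     smooth_manifold (arrows \<Gamma>) \<and> smooth_manifold (objects \<Gamma>) \<and>
     submersion (arrows \<Gamma>) (objects \<Gamma>) (src \<Gamma>) \<and>
     submersion (arrows \<Gamma>) (objects \<Gamma>) (tgt \<Gamma>) \<and>
     smooth_map (objects \<Gamma>) (arrows \<Gamma>) (ident \<Gamma>) \<and>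
     smooth_map (arrows \<Gamma>) (arrows \<Gamma>) (inver \<Gamma>) \<and>
     smooth_map_on (prod_mfd (arrows \<Gamma>) (arrows \<Gamma>)) (composable \<Gamma>) (arrows \<Gamma>)
       (\<lambda>(g, h). mult \<Gamma> g h) \<and>
     (\<forall>(g, h)\<in>composable \<Gamma>.
        src \<Gamma> (mult \<Gamma> g h) = src \<Gamma> g \<and> tgt \<Gamma> (mult \<Gamma> g h) = tgt \<Gamma> h) \<and>
     (\<forall>g h k. (g, h) \<in> composable \<Gamma> \<and> (h, k) \<in> composable \<Gamma> \<longrightarrow>
        mult \<Gamma> (mult \<Gamma> g h) k = mult \<Gamma> g (mult \<Gamma> h k)) \<and>
     (\<forall>x\<in>pts (objects \<Gamma>). src \<Gamma> (ident \<Gamma> x) = x \<and> tgt \<Gamma> (ident \<Gamma> x) = x) \<and>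
     (\<forall>g\<in>pts (arrows \<Gamma>).
        mult \<Gamma> (ident \<Gamma> (src \<Gamma> g)) g = g \<and> mult \<Gamma> g (ident \<Gamma> (tgt \<Gamma> g)) = g \<and>
        src \<Gamma> (inver \<Gamma> g) = tgt \<Gamma> g \<and> tgt \<Gamma> (inver \<Gamma> g) = src \<Gamma> g \<and>
        mult \<Gamma> g (inver \<Gamma> g) = ident \<Gamma> (src \<Gamma> g) \<and>
        mult \<Gamma> (inver \<Gamma> g) g = ident \<Gamma> (tgt \<Gamma> g))"

definition src_fibre :: "('g, 'e, 'm, 'f) groupoid \<Rightarrow> 'm \<Rightarrow> 'g set" where
  "src_fibre \<Gamma> x = {k \<in> pts (arrows \<Gamma>). src \<Gamma> k = x}"

definition tgt_fibre :: "('g, 'e, 'm, 'f) groupoid \<Rightarrow> 'm \<Rightarrow> 'g set" where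
  "tgt_fibre \<Gamma> x = {k \<in> pts (arrows \<Gamma>). tgt \<Gamma> k = x}"

text \<open>Left and right translations are only meaningful on \<open>src_fibre \<Gamma> (tgt \<Gamma> g)\<close> and on
  \<open>tgt_fibre \<Gamma> (src \<Gamma> h)\<close>, respectively.\<close>

definition ltrans :: "('g, 'e, 'm, 'f) groupoid \<Rightarrow> 'g \<Rightarrow> 'g \<Rightarrow> 'g" where
  "ltrans \<Gamma> g = (\<lambda>k. mult \<Gamma> g k)"

definition rtrans :: "('g, 'e, 'm, 'f) groupoid \<Rightarrow> 'g \<Rightarrow> 'g \<Rightarrow> 'g" where
  "rtrans \<Gamma> h = (\<lambda>k. mult \<Gamma> k h)"

definition algebroid_fibre ::
    "('g, 'e::euclidean_space, 'm, 'f::euclidean_space) groupoid \<Rightarrow> 'm \<Rightarrow> ('g, 'e) tvec set" where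
  "algebroid_fibre \<Gamma> x = {X \<in> tangent_space (arrows \<Gamma>) (ident \<Gamma> x).
     tangent_map (arrows \<Gamma>) (objects \<Gamma>) (src \<Gamma>) (ident \<Gamma> x) X = (\<lambda>_. 0)}"


section \<open>The cotangent groupoid and the discrete Euler--Lagrange equations\<close>

text \<open>Elements of the dual algebroid are pairs of a base point \<open>x\<close> and a functional on the fibre over
  \<open>x\<close>, like those of the cotangent bundle.\<close>

definition cot_tgt ::
    "('g, 'e::euclidean_space, 'm, 'f::euclidean_space) groupoid \<Rightarrow>
     'g \<times> (('g, 'e) tvec \<Rightarrow> real) \<Rightarrow> 'm \<times> (('g, 'e) tvec \<Rightarrow> real)" where
  "cot_tgt \<Gamma> = (\<lambda>(g, \<mu>). (tgt \<Gamma> g,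
     \<lambda>X\<in>algebroid_fibre \<Gamma> (tgt \<Gamma> g).
       \<mu> (tangent_map_on (arrows \<Gamma>) (src_fibre \<Gamma> (tgt \<Gamma> g)) (arrows \<Gamma>) (ltrans \<Gamma> g)
            (ident \<Gamma> (tgt \<Gamma> g)) X)))"

definition cot_src ::
    "('g, 'e::euclidean_space, 'm, 'f::euclidean_space) groupoid \<Rightarrow>
     'g \<times> (('g, 'e) tvec \<Rightarrow> real) \<Rightarrow> 'm \<times> (('g, 'e) tvec \<Rightarrow> real)" where
  "cot_src \<Gamma> = (\<lambda>(h, \<nu>). (src \<Gamma> h,
     \<lambda>Y\<in>algebroid_fibre \<Gamma> (src \<Gamma> h).
       \<nu> (tangent_map_on (arrows \<Gamma>) (tgt_fibre \<Gamma> (src \<Gamma> h)) (arrows \<Gamma>) (rtrans \<Gamma> h)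
            (ident \<Gamma> (src \<Gamma> h))
            (Y - tangent_map (arrows \<Gamma>) (arrows \<Gamma>) (ident \<Gamma> \<circ> tgt \<Gamma>) (ident \<Gamma> (src \<Gamma> h)) Y))))"

text \<open>First step of the forward integrability algorithm for the implicit difference equation \<open>E\<close>
  on a groupoid with set of arrows \<open>C\<close>, source \<open>s\<close> and target \<open>t\<close>.\<close>

definition forward_step :: "'c set \<Rightarrow> ('c \<Rightarrow> 'b) \<Rightarrow> ('c \<Rightarrow> 'b) \<Rightarrow> 'c set \<Rightarrow> 'c set" where
  "forward_step C s t E = E \<inter> {\<mu> \<in> C. t \<mu> \<in> s ` E}"

definition lagrangian_eqn ::
    "('g, 'e::euclidean_space, 'm, 'f::euclidean_space) groupoid \<Rightarrow> ('g \<Rightarrow> real) \<Rightarrow>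
     ('g \<times> (('g, 'e) tvec \<Rightarrow> real)) set" where
  "lagrangian_eqn \<Gamma> L = d_section (arrows \<Gamma>) L ` pts (arrows \<Gamma>)"

definition lagrangian_forward_step ::
    "('g, 'e::euclidean_space, 'm, 'f::euclidean_space) groupoid \<Rightarrow> ('g \<Rightarrow> real) \<Rightarrow>
     ('g \<times> (('g, 'e) tvec \<Rightarrow> real)) set" where
  "lagrangian_forward_step \<Gamma> L =
     forward_step (cotangent_bundle (arrows \<Gamma>)) (cot_src \<Gamma>) (cot_tgt \<Gamma>) (lagrangian_eqn \<Gamma> L)"

text \<open>The function is differentiated on the source fibre over \<open>x\<close>, the only place where it makes
  sense; that manifold has \<open>algebroid_fibre \<Gamma> x\<close> as its tangent space at \<open>ident \<Gamma> x\<close>.\<close>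

definition discrete_EL ::
    "('g, 'e::euclidean_space, 'm, 'f::euclidean_space) groupoid \<Rightarrow> ('g \<Rightarrow> real) \<Rightarrow> 'g \<Rightarrow> 'g \<Rightarrow> bool" where
  "discrete_EL \<Gamma> L g h \<longleftrightarrow> (let x = tgt \<Gamma> g in
     \<forall>X\<in>algebroid_fibre \<Gamma> x.
       differential_on (arrows \<Gamma>) (src_fibre \<Gamma> x)
         (\<lambda>k. (L \<circ> ltrans \<Gamma> g) k + (L \<circ> rtrans \<Gamma> h \<circ> inver \<Gamma>) k) (ident \<Gamma> x) X = 0)"

end

theory Submission
  imports Defs
begin

text \<open>
  Both sides of the comparison are derivatives of \<open>L\<close> along curves. Let \<open>x = tgt g = src h\<close>,
  let \<open>X\<close> lie in the algebroid fibre over \<open>x\<close>, and suppose that \<open>X\<close> is the velocity at \<open>0\<close> of a curve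
  \<open>\<gamma>\<close> that starts at \<open>\<epsilon> x\<close> and stays in the source fibre over \<open>x\<close>. The tangent map of left translation
  sends \<open>X\<close> to the velocity of \<open>g \<gamma>(t)\<close>, so the target of \<open>dL(g)\<close>, evaluated at \<open>X\<close>, is the derivative of
  \<open>L(g \<gamma>(t))\<close> at \<open>0\<close>.

  For the source of \<open>dL(h)\<close>, differentiate the identity \<open>i(\<gamma>(t)) \<gamma>(t) = \<epsilon>(\<beta>(\<gamma>(t)))\<close> at \<open>0\<close>. The tangent map of
  the multiplication is linear, and multiplying by the unit \<open>\<epsilon> x\<close> on either side changes nothing, so the
  left-hand side contributes \<open>Ti X + X\<close>. Hence \<open>X - T(\<epsilon> \<circ> \<beta>) X = - Ti X\<close> is the velocity
  of the curve \<open>i(\<gamma>(-t))\<close> in the target fibre (\<open>inver_velocity\<close>), and the source of \<open>dL(h)\<close>, evaluated at \<open>X\<close>, is minus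
  the derivative of \<open>L(i(\<gamma>(t)) h)\<close>. The discrete Euler-Lagrange expression at \<open>X\<close> is the sum of the two
  derivatives, that is, the difference of the two functionals at \<open>X\<close> (\<open>discrete_EL_iff\<close>).

  What this needs from differential geometry is, first, that smooth maps act linearly on velocities,
  in a form that also covers maps defined on submanifolds such as the set of composable pairs
  (\<open>smooth_map_on_velocity\<close>); second, that every vector in the kernel of the tangent map of a submersion is
  the velocity of a curve inside the fibre (\<open>submersion_kernel_curve\<close>), which rests on
  the inverse function theorem.

  The description of the forward step is then formal: membership asks for some \<open>h\<close> such that the target of
  \<open>dL(g)\<close> equals the source of \<open>dL(h)\<close>, and equality of the base points of these covectors says that \<open>(g, h)\<close> is
  composable.
\<close>

section \<open>Derivatives of the smooth extensions\<close>

lemma Ck_on_const: "Ck_on k U (\<lambda>x. c)"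
  by (induction k arbitrary: c) auto

lemma Ck_on_id: "Ck_on k U (\<lambda>x. x)"
  by (cases k) (auto simp: Ck_on_const)

lemma smooth_onE:
  assumes "smooth_on A f" and "x \<in> A"
  obtains U f' where "open U" "x \<in> U" "\<And>y. y \<in> A \<Longrightarrow> y \<in> U \<Longrightarrow> f' y = f y" "\<And>k. Ck_on k U f'"
  using assms unfolding smooth_on_def by (metis IntI)

lemma Ck_on_has_derivative:
  assumes "Ck_on 1 U f" "open U" "x \<in> U"
  shows "(f has_derivative frechet_derivative f (at x)) (at x)"
  using assms
  by (auto simp: differentiable_on_eq_differentiable_at frechet_derivative_works)

text \<open>The chain rule along a curve, for functions that factor through \<open>f\<close> only near \<open>0\<close>: coordinate
  expressions of smooth maps agree with their smooth extensions only locally.\<close>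

lemma has_vector_derivative_smooth_image:
  assumes f: "Ck_on 1 U f" "open U" "\<kappa> 0 \<in> U"
    and \<kappa>: "(\<kappa> has_vector_derivative v) (at 0)"
    and eq: "\<forall>\<^sub>F t in nhds (0::real). \<eta> t = f (\<kappa> t)"
  shows "(\<eta> has_vector_derivative frechet_derivative f (at (\<kappa> 0)) v) (at 0)"
proof -
  have d: "(f has_derivative frechet_derivative f (at (\<kappa> 0))) (at (\<kappa> 0))"
    using f by (intro Ck_on_has_derivative) auto
  have "((f \<circ> \<kappa>) has_vector_derivative frechet_derivative f (at (\<kappa> 0)) v) (at 0)"
    using vector_derivative_diff_chain_within[OF \<kappa> has_derivative_at_withinI[OF d]] by simp
  moreover from eq obtain S where "open S" "0 \<in> S" "\<And>t. t \<in> S \<Longrightarrow> f (\<kappa> t) = \<eta> t"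
    unfolding eventually_nhds by metis
  ultimately show ?thesis
    by (intro has_vector_derivative_transform_within_open[of "f \<circ> \<kappa>" _ 0 S \<eta>]) auto
qed

lemma has_vector_derivative_reflect:
  assumes "(f has_vector_derivative v) (at 0)"
  shows "((\<lambda>t. f (- t)) has_vector_derivative - v) (at (0::real))"
proof -
  have "(uminus has_vector_derivative -1) (at (0::real))"
    by (auto intro!: derivative_eq_intros simp: has_real_derivative_iff_has_vector_derivative[symmetric])
  moreover have "(f has_vector_derivative v) (at (- 0))" using assms by simp
  ultimately show ?thesis
    using vector_diff_chain_at[of uminus "-1" 0 f v] by (simp add: o_def)
qed

section \<open>Curves and charts\<close>

text \<open>The part of the manifold axioms that concerns the domain of a smooth map. It passes to products of
  manifolds by inspection of the product charts, so multiplication can be treated as a smooth map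
  without a proof that the product is again a smooth manifold.\<close>

definition continuous_charts :: "('a, 'e::euclidean_space) mfd \<Rightarrow> bool" where
  "continuous_charts M \<longleftrightarrow> (\<forall>c\<in>mfd_atlas M. openin (mfd_top M) (fst c) \<and> inj_on (snd c) (fst c) \<and>
     continuous_map (subtopology (mfd_top M) (fst c)) euclidean (snd c))"

lemma smooth_manifold_continuous_charts:
  assumes "smooth_manifold M"
  shows "continuous_charts M"
  unfolding continuous_charts_def
proof (intro ballI conjI)
  fix c assume "c \<in> mfd_atlas M"
  with assms have o: "openin (mfd_top M) (fst c)" and
    h: "homeomorphic_map (subtopology (mfd_top M) (fst c)) (top_of_set (snd c ` fst c)) (snd c)"
    by (auto simp: smooth_manifold_def)
  show "openin (mfd_top M) (fst c)" by fact
  have "topspace (subtopology (mfd_top M) (fst c)) = fst c"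
    using openin_subset[OF o] by (auto simp: topspace_subtopology)
  then show "inj_on (snd c) (fst c)"
    using homeomorphic_imp_injective_map[OF h] by simp
  show "continuous_map (subtopology (mfd_top M) (fst c)) euclidean (snd c)"
    using homeomorphic_imp_continuous_map[OF h] by (simp add: continuous_map_in_subtopology)
qed

lemma continuous_charts_prod_mfd:
  assumes "continuous_charts M" "continuous_charts N"
  shows "continuous_charts (prod_mfd M N)"
  unfolding continuous_charts_def
proof
  fix cd assume "cd \<in> mfd_atlas (prod_mfd M N)"
  then obtain c d where cd: "cd = (fst c \<times> fst d, map_prod (snd c) (snd d))"
    "c \<in> mfd_atlas M" "d \<in> mfd_atlas N" by (auto simp: prod_mfd_def)
  from cd assms have c: "openin (mfd_top M) (fst c)" "inj_on (snd c) (fst c)"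
     "continuous_map (subtopology (mfd_top M) (fst c)) euclidean (snd c)"
    and d: "openin (mfd_top N) (fst d)" "inj_on (snd d) (fst d)"
     "continuous_map (subtopology (mfd_top N) (fst d)) euclidean (snd d)"
    by (auto simp: continuous_charts_def)
  have "continuous_map (prod_topology (subtopology (mfd_top M) (fst c)) (subtopology (mfd_top N) (fst d)))
    (prod_topology euclidean euclidean) (map_prod (snd c) (snd d))"
    unfolding continuous_map_pairwise fst_comp_map_prod snd_comp_map_prod
    using c(3) d(3) by (auto intro!: continuous_map_compose continuous_map_fst continuous_map_snd)
  then have "continuous_map (subtopology (prod_topology (mfd_top M) (mfd_top N)) (fst c \<times> fst d))
    euclidean (map_prod (snd c) (snd d))"
    by (simp add: subtopology_Times euclidean_product_topology)
  then show "openin (mfd_top (prod_mfd M N)) (fst cd) \<and> inj_on (snd cd) (fst cd) \<and>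
     continuous_map (subtopology (mfd_top (prod_mfd M N)) (fst cd)) euclidean (snd cd)"
    using c d by (auto simp: cd prod_mfd_def openin_prod_Times_iff map_prod_inj_on)
qed

lemma chart_inv_cancel:
  assumes "continuous_charts M" "c \<in> mfd_atlas M" "x \<in> fst c"
  shows "chart_inv c (snd c x) = x"
  using assms by (auto simp: chart_inv_def continuous_charts_def)

lemma chart_inv_in: "v \<in> snd c ` fst c \<Longrightarrow> chart_inv c v \<in> fst c \<and> snd c (chart_inv c v) = v"
  by (auto simp: chart_inv_def inv_into_into f_inv_into_f)

lemma smooth_manifold_continuous_chart_inv:
  assumes M: "smooth_manifold M" and c: "c \<in> mfd_atlas M"
  shows "continuous_map (top_of_set (snd c ` fst c)) (mfd_top M) (chart_inv c)"
proof -
  from assms have o: "openin (mfd_top M) (fst c)" and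
    h: "homeomorphic_map (subtopology (mfd_top M) (fst c)) (top_of_set (snd c ` fst c)) (snd c)"
    by (auto simp: smooth_manifold_def)
  have ts: "topspace (subtopology (mfd_top M) (fst c)) = fst c"
    using openin_subset[OF o] by (auto simp: topspace_subtopology)
  from h obtain g where g: "homeomorphic_maps (subtopology (mfd_top M) (fst c)) (top_of_set (snd c ` fst c)) (snd c) g"
    using homeomorphic_map_maps by blast
  have "continuous_map (top_of_set (snd c ` fst c)) (mfd_top M) g"
    using g by (auto simp: homeomorphic_maps_def continuous_map_in_subtopology)
  moreover have "g v = chart_inv c v" if v: "v \<in> snd c ` fst c" for v
  proof -
    from v obtain x where x: "x \<in> fst c" "v = snd c x" by auto
    with g ts have "g v = x" by (auto simp: homeomorphic_maps_def)
    then show ?thesis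
      using x chart_inv_cancel[OF smooth_manifold_continuous_charts[OF M] c] by simp
  qed
  ultimately show ?thesis
    by (auto intro: continuous_map_eq)
qed

lemma eventually_nhds_0_iff:
  "(\<forall>\<^sub>F t in nhds (0::real). P t) \<longleftrightarrow> (\<exists>\<delta>>0. \<forall>t\<in>{-\<delta><..<\<delta>}. P t)"
proof -
  have "dist t 0 < \<delta> \<longleftrightarrow> t \<in> {-\<delta><..<\<delta>}" for t \<delta> :: real by (auto simp: dist_real_def)
  then show ?thesis unfolding eventually_nhds_metric by metis
qed

lemma continuous_curve_eventually_in:
  assumes \<gamma>: "\<gamma> 0 = p" "\<delta> > 0" "continuous_map (top_of_set {-\<delta><..<\<delta>}) X \<gamma>"
    and W: "openin X W" "p \<in> W"
  shows "\<forall>\<^sub>F t in nhds (0::real). \<gamma> t \<in> W"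
proof -
  from \<gamma>(3) W have "openin (top_of_set {-\<delta><..<\<delta>}) {t \<in> {-\<delta><..<\<delta>}. \<gamma> t \<in> W}"
    by (auto simp: continuous_map_def)
  then have "open {t \<in> {-\<delta><..<\<delta>}. \<gamma> t \<in> W}"
    using openin_open_trans open_greaterThanLessThan by blast
  then show ?thesis
    unfolding eventually_nhds using \<gamma> W by (intro exI[of _ "{t \<in> {-\<delta><..<\<delta>}. \<gamma> t \<in> W}"]) auto
qed

lemma curve_at_eventually_in:
  assumes \<gamma>: "curve_at M S p \<gamma>" and W: "openin (mfd_top M) W" "p \<in> W"
  shows "\<forall>\<^sub>F t in nhds 0. \<gamma> t \<in> W \<inter> S"
proof -
  from \<gamma> obtain \<delta> where \<delta>: "\<delta> > 0" "\<gamma> ` {-\<delta><..<\<delta>} \<subseteq> S"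
      "continuous_map (top_of_set {-\<delta><..<\<delta>}) (mfd_top M) \<gamma>" and "\<gamma> 0 = p"
    by (auto simp: curve_at_def)
  have "\<forall>\<^sub>F t in nhds 0. t \<in> {-\<delta><..<\<delta>}"
    using \<delta>(1) by (intro eventually_nhds_in_open) auto
  then have "\<forall>\<^sub>F t in nhds 0. \<gamma> t \<in> S" by (rule eventually_mono) (use \<delta>(2) in blast)
  with continuous_curve_eventually_in[OF \<open>\<gamma> 0 = p\<close> \<delta>(1,3) W] show ?thesis
    by eventually_elim simp
qed

lemma curve_at_restrict:
  assumes \<gamma>: "curve_at M S p \<gamma>" and T: "\<forall>\<^sub>F t in nhds 0. \<gamma> t \<in> T"
  shows "curve_at M T p \<gamma>"
proof -
  from \<gamma> obtain \<delta> where \<delta>: "\<delta> > 0"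
      "continuous_map (top_of_set {-\<delta><..<\<delta>}) (mfd_top M) \<gamma>"
    by (auto simp: curve_at_def)
  from T obtain e where e: "e > 0" "\<forall>t\<in>{-e<..<e}. \<gamma> t \<in> T" unfolding eventually_nhds_0_iff by auto
  have "continuous_map (top_of_set {-(min \<delta> e)<..<min \<delta> e}) (mfd_top M) \<gamma>"
    by (rule continuous_map_from_subtopology_mono[OF \<delta>(2)]) auto
  then have "\<exists>\<delta>>0. \<gamma> ` {-\<delta><..<\<delta>} \<subseteq> T \<and> continuous_map (top_of_set {-\<delta><..<\<delta>}) (mfd_top M) \<gamma>"
    using \<delta> e by (intro exI[of _ "min \<delta> e"]) auto
  with \<gamma> show ?thesis by (auto simp: curve_at_def)
qed

lemma curve_at_mono: "curve_at M S p \<gamma> \<Longrightarrow> S \<subseteq> T \<Longrightarrow> curve_at M T p \<gamma>"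
  unfolding curve_at_def by blast

lemma curve_at_0: "curve_at M S p \<gamma> \<Longrightarrow> \<gamma> 0 = p"
  by (simp add: curve_at_def)

lemma curve_at_in:
  assumes "curve_at M S p \<gamma>" shows "p \<in> S"
proof -
  from assms obtain \<delta> where "\<delta> > 0" "\<gamma> ` {-\<delta><..<\<delta>} \<subseteq> S" "\<gamma> 0 = p"
    by (auto simp: curve_at_def)
  moreover from this have "0 \<in> {-\<delta><..<\<delta>}" by simp
  ultimately show ?thesis by blast
qed

lemma curve_at_has_vector_derivative:
  assumes "curve_at M S p \<gamma>" "c \<in> charts_at M p"
  shows "((\<lambda>t. snd c (\<gamma> t)) has_vector_derivative velocity M \<gamma> c) (at 0)"
  using assms by (auto simp: curve_at_def velocity_def vector_derivative_works o_def)

lemma velocity_eq: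
  assumes "\<gamma> 0 = p" "c \<in> charts_at M p" "((\<lambda>t. snd c (\<gamma> t)) has_vector_derivative v) (at 0)"
  shows "velocity M \<gamma> c = v"
  using assms by (auto simp: velocity_def o_def vector_derivative_at)

text \<open>Velocities depend on germs only. A curve in a fibre satisfies the groupoid identities only near
  \<open>0\<close>, since its values elsewhere may lie outside the manifold.\<close>

lemma velocity_cong:
  fixes M :: "('a, 'e::euclidean_space) mfd"
  assumes "\<forall>\<^sub>F t in nhds 0. \<gamma> t = \<eta> t"
  shows "velocity M \<gamma> = velocity M \<eta>"
proof
  fix c :: "('a, 'e) chart"
  have "vector_derivative (snd c \<circ> \<gamma>) (at 0) = vector_derivative (snd c \<circ> \<eta>) (at 0)"
    using assms by (intro vector_derivative_cong_eq) (auto elim: eventually_mono)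
  then show "velocity M \<gamma> c = velocity M \<eta> c"
    using eventually_nhds_x_imp_x[OF assms] by (simp add: velocity_def)
qed

text \<open>The derivative of a smooth extension of the change of coordinates. The curve is required to be
  differentiable in the first chart only, so differentiability in a single chart gives it in all
  of them.\<close>

lemma chart_transition:
  assumes M: "smooth_manifold M" and c: "c \<in> charts_at M p" and d: "d \<in> charts_at M p"
  shows "\<exists>D. linear D \<and> (\<forall>\<gamma> v. \<gamma> 0 = p \<longrightarrow> (\<forall>\<^sub>F t in nhds 0. \<gamma> t \<in> fst c \<inter> fst d) \<longrightarrow>
       ((\<lambda>t. snd c (\<gamma> t)) has_vector_derivative v) (at 0) \<longrightarrow>
       ((\<lambda>t. snd d (\<gamma> t)) has_vector_derivative D v) (at 0))"
proof -
  from c d have cd: "c \<in> mfd_atlas M" "d \<in> mfd_atlas M" "p \<in> fst c" "p \<in> fst d"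
    by (auto simp: charts_at_def)
  with M have "smooth_on (snd c ` (fst c \<inter> fst d)) (snd d \<circ> chart_inv c)"
    by (auto simp: smooth_manifold_def)
  then obtain U \<tau> where \<tau>: "open U" "snd c p \<in> U" "\<And>k. Ck_on k U \<tau>"
    "\<And>y. y \<in> snd c ` (fst c \<inter> fst d) \<Longrightarrow> y \<in> U \<Longrightarrow> \<tau> y = (snd d \<circ> chart_inv c) y"
    using cd by (elim smooth_onE[of _ _ "snd c p"]) auto
  show ?thesis
  proof (intro exI conjI allI impI)
    show "linear (frechet_derivative \<tau> (at (snd c p)))"
      using Ck_on_has_derivative[OF \<tau>(3) \<tau>(1,2)] has_derivative_linear by blast
    fix \<gamma> v assume \<gamma>: "\<gamma> 0 = p" "\<forall>\<^sub>F t in nhds 0. \<gamma> t \<in> fst c \<inter> fst d"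
       "((\<lambda>t. snd c (\<gamma> t)) has_vector_derivative v) (at 0)"
    have "isCont (\<lambda>t. snd c (\<gamma> t)) 0"
      using \<gamma>(3) has_vector_derivative_continuous by blast
    then have "\<forall>\<^sub>F t in nhds 0. snd c (\<gamma> t) \<in> U"
      using \<tau>(1,2) \<gamma>(1) by (metis continuous_within eventually_at_topological tendsto_def
          eventually_nhds_conv_at topological_tendstoD)
    with \<gamma>(2) have "\<forall>\<^sub>F t in nhds 0. snd d (\<gamma> t) = \<tau> (snd c (\<gamma> t))"
    proof eventually_elim
      case (elim t)
      then show ?case
        using \<tau>(4)[of "snd c (\<gamma> t)"] chart_inv_cancel[OF smooth_manifold_continuous_charts[OF M] cd(1)] by auto
    qed
    from has_vector_derivative_smooth_image[OF \<tau>(3) \<tau>(1) _ \<gamma>(3) this] \<tau>(2) \<gamma>(1)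
    show "((\<lambda>t. snd d (\<gamma> t)) has_vector_derivative frechet_derivative \<tau> (at (snd c p)) v) (at 0)"
      by simp
  qed
qed

lemma charts_at_openin: "smooth_manifold M \<Longrightarrow> c \<in> charts_at M p \<Longrightarrow> openin (mfd_top M) (fst c) \<and> p \<in> fst c"
  by (auto simp: charts_at_def smooth_manifold_def)

text \<open>Membership in \<open>curve_at\<close> can be tested in a single chart.\<close>

lemma curve_at_chartI:
  assumes M: "smooth_manifold M" and c: "c \<in> charts_at M p"
    and \<gamma>: "\<gamma> 0 = p" "\<delta> > 0" "continuous_map (top_of_set {-\<delta><..<\<delta>}) (mfd_top M) \<gamma>"
    and v: "((\<lambda>t. snd c (\<gamma> t)) has_vector_derivative v) (at 0)"
  shows "curve_at M (pts M) p \<gamma>"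
proof -
  note ev = continuous_curve_eventually_in[OF \<gamma>]
  have "(snd d \<circ> \<gamma>) differentiable (at 0)" if d: "d \<in> charts_at M p" for d
  proof -
    obtain D where tr: "\<forall>\<gamma> v. \<gamma> 0 = p \<longrightarrow> (\<forall>\<^sub>F t in nhds 0. \<gamma> t \<in> fst c \<inter> fst d) \<longrightarrow>
       ((\<lambda>t. snd c (\<gamma> t)) has_vector_derivative v) (at 0) \<longrightarrow>
       ((\<lambda>t. snd d (\<gamma> t)) has_vector_derivative D v) (at 0)"
      using chart_transition[OF M c d] by blast
    have "\<forall>\<^sub>F t in nhds 0. \<gamma> t \<in> fst c \<inter> fst d"
      using charts_at_openin[OF M c] charts_at_openin[OF M d] by (intro ev) auto
    with tr \<gamma>(1) v have "((\<lambda>t. snd d (\<gamma> t)) has_vector_derivative D v) (at 0)" by blast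
    then show ?thesis
      unfolding o_def by (rule differentiableI_vector)
  qed
  moreover have "\<gamma> ` {-\<delta><..<\<delta>} \<subseteq> pts M"
    using \<gamma>(3) by (auto simp: continuous_map_def)
  ultimately show ?thesis
    using \<gamma> by (auto simp: curve_at_def)
qed

text \<open>The coordinates of a velocity in one chart determine the whole vector, linearly. Taking \<open>D d = 0\<close>
  for the charts \<open>d\<close> away from \<open>p\<close> matches the convention that velocities vanish there.\<close>

lemma velocity_transition:
  assumes M: "smooth_manifold M" and c: "c \<in> charts_at M p"
  shows "\<exists>D. (\<forall>d. linear (D d)) \<and>
    (\<forall>S \<gamma> d. curve_at M S p \<gamma> \<longrightarrow> velocity M \<gamma> d = D d (velocity M \<gamma> c))"
proof -
  have "\<exists>D. linear D \<and> (\<forall>S \<gamma>. curve_at M S p \<gamma> \<longrightarrow> velocity M \<gamma> d = D (velocity M \<gamma> c))" for d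
  proof (cases "d \<in> charts_at M p")
    case d: True
    obtain D where D: "linear D" "\<forall>\<gamma> v. \<gamma> 0 = p \<longrightarrow> (\<forall>\<^sub>F t in nhds 0. \<gamma> t \<in> fst c \<inter> fst d) \<longrightarrow>
       ((\<lambda>t. snd c (\<gamma> t)) has_vector_derivative v) (at 0) \<longrightarrow>
       ((\<lambda>t. snd d (\<gamma> t)) has_vector_derivative D v) (at 0)"
      using chart_transition[OF M c d] by blast
    have "velocity M \<gamma> d = D (velocity M \<gamma> c)" if \<gamma>: "curve_at M S p \<gamma>" for S \<gamma>
    proof -
      have "\<forall>\<^sub>F t in nhds 0. \<gamma> t \<in> (fst c \<inter> fst d) \<inter> S"
        using charts_at_openin[OF M c] charts_at_openin[OF M d]
        by (intro curve_at_eventually_in[OF \<gamma>]) auto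
      then have "\<forall>\<^sub>F t in nhds 0. \<gamma> t \<in> fst c \<inter> fst d"
        by (rule eventually_mono) auto
      with D(2) curve_at_0[OF \<gamma>] curve_at_has_vector_derivative[OF \<gamma> c]
      have "((\<lambda>t. snd d (\<gamma> t)) has_vector_derivative D (velocity M \<gamma> c)) (at 0)" by blast
      then show ?thesis
        by (rule velocity_eq[where \<gamma> = \<gamma>, OF curve_at_0[OF \<gamma>] d])
    qed
    with D show ?thesis by blast
  next
    case False
    have "velocity M \<gamma> d = 0" if "curve_at M S p \<gamma>" for S \<gamma>
      using False curve_at_0[OF that] by (simp add: velocity_def)
    then show ?thesis
      using linear_zero by (intro exI[of _ "\<lambda>_. 0"]) blast
  qed
  then have "\<forall>d. \<exists>D. linear D \<and> (\<forall>S \<gamma>. curve_at M S p \<gamma> \<longrightarrow> velocity M \<gamma> d = D (velocity M \<gamma> c))"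
    by blast
  then obtain D where "\<forall>d. linear (D d) \<and>
      (\<forall>S \<gamma>. curve_at M S p \<gamma> \<longrightarrow> velocity M \<gamma> d = D d (velocity M \<gamma> c))"
    by (rule choice[THEN exE])
  then show ?thesis by blast
qed

lemma velocity_eqI:
  assumes M: "smooth_manifold M" and c: "c \<in> charts_at M p"
    and "curve_at M S p \<gamma>" "curve_at M T p \<eta>" "velocity M \<gamma> c = velocity M \<eta> c"
  shows "velocity M \<gamma> = velocity M \<eta>"
proof -
  obtain D where "\<forall>S \<gamma> d. curve_at M S p \<gamma> \<longrightarrow> velocity M \<gamma> d = D d (velocity M \<gamma> c)"
    using velocity_transition[OF M c] by blast
  then show ?thesis using assms(3-5) by (intro ext) metis
qed

section \<open>Smooth maps act on curves\<close>

text \<open>A coordinate expression of \<open>F\<close> near \<open>p\<close>, with its smooth extension \<open>\<phi>\<close> to an open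
  set of the ambient Euclidean space. For a submersion the
  derivative of \<open>\<phi>\<close> itself is of interest, not just its effect on velocities.\<close>

definition local_representative where
  "local_representative M S N F p c d W U \<phi> \<longleftrightarrow>
     c \<in> charts_at M p \<and> d \<in> charts_at N (F p) \<and>
     openin (mfd_top M) W \<and> p \<in> W \<and> W \<subseteq> fst c \<and> F ` (W \<inter> S) \<subseteq> fst d \<and>
     open U \<and> snd c p \<in> U \<and> (\<forall>k. Ck_on k U \<phi>) \<and>
     (\<forall>x\<in>W \<inter> S. snd c x \<in> U \<longrightarrow> \<phi> (snd c x) = snd d (F x))"

lemma smooth_map_on_local_representative:
  assumes M: "continuous_charts M" and F: "smooth_map_on M S N F" and p: "p \<in> S"
  obtains c d W U \<phi> where "local_representative M S N F p c d W U \<phi>"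
proof -
  from F p obtain c d W where cd: "c \<in> charts_at M p" "d \<in> charts_at N (F p)"
     "openin (mfd_top M) W" "p \<in> W" "W \<subseteq> fst c" "F ` (W \<inter> S) \<subseteq> fst d"
     "smooth_on (snd c ` (W \<inter> S)) (snd d \<circ> F \<circ> chart_inv c)"
    unfolding smooth_map_on_def by blast
  from cd(7) obtain U \<phi> where U: "open U" "snd c p \<in> U"
     "\<And>y. y \<in> snd c ` (W \<inter> S) \<Longrightarrow> y \<in> U \<Longrightarrow> \<phi> y = (snd d \<circ> F \<circ> chart_inv c) y" "\<And>k. Ck_on k U \<phi>"
    using p cd(4) by (elim smooth_onE[of _ _ "snd c p"]) auto
  have "\<phi> (snd c x) = snd d (F x)" if "x \<in> W \<inter> S" "snd c x \<in> U" for x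
  proof -
    have "chart_inv c (snd c x) = x"
      using that cd(1,5) by (intro chart_inv_cancel[OF M]) (auto simp: charts_at_def)
    with U(3)[of "snd c x"] that show ?thesis by auto
  qed
  with cd U have "local_representative M S N F p c d W U \<phi>"
    unfolding local_representative_def by simp
  then show thesis by (rule that)
qed

lemma curve_at_chart_continuous:
  assumes M: "continuous_charts M" and \<gamma>: "curve_at M S p \<gamma>" and c: "c \<in> mfd_atlas M"
    and W: "openin (mfd_top M) W" "p \<in> W" "W \<subseteq> fst c"
  obtains \<delta> where "\<delta> > 0" "\<gamma> ` {-\<delta><..<\<delta>} \<subseteq> W \<inter> S" "continuous_on {-\<delta><..<\<delta>} (\<lambda>t. snd c (\<gamma> t))"
proof -
  from curve_at_eventually_in[OF \<gamma> W(1,2)] have "curve_at M (W \<inter> S) p \<gamma>"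
    by (rule curve_at_restrict[OF \<gamma>])
  then obtain \<delta> where \<delta>: "\<delta> > 0" "\<gamma> ` {-\<delta><..<\<delta>} \<subseteq> W \<inter> S"
     "continuous_map (top_of_set {-\<delta><..<\<delta>}) (mfd_top M) \<gamma>"
    by (auto simp: curve_at_def)
  with W have "continuous_map (top_of_set {-\<delta><..<\<delta>}) (subtopology (mfd_top M) (fst c)) \<gamma>"
    by (auto simp: continuous_map_in_subtopology)
  moreover have "continuous_map (subtopology (mfd_top M) (fst c)) euclidean (snd c)"
    using M c by (auto simp: continuous_charts_def)
  ultimately have "continuous_map (top_of_set {-\<delta><..<\<delta>}) euclidean (snd c \<circ> \<gamma>)"
    by (rule continuous_map_compose)
  with \<delta> that show thesis by (auto simp: o_def)
qed

text \<open>Near \<open>0\<close> the image curve is, in coordinates, \<open>\<phi>\<close> applied to the coordinates of \<open>\<gamma>\<close>. This gives its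
  continuity as well as its velocity by the chain rule.\<close>

lemma local_representative_curve:
  assumes M: "continuous_charts M" and N: "smooth_manifold N"
    and F: "local_representative M S N F p c d W U \<phi>" and \<gamma>: "curve_at M S p \<gamma>"
  shows "curve_at N (F ` S) (F p) (F \<circ> \<gamma>)"
    and "velocity N (F \<circ> \<gamma>) d = frechet_derivative \<phi> (at (snd c p)) (velocity M \<gamma> c)"
proof -
  from F have c: "c \<in> charts_at M p" and d: "d \<in> charts_at N (F p)"
    and W: "openin (mfd_top M) W" "p \<in> W" "W \<subseteq> fst c" and FW: "F ` (W \<inter> S) \<subseteq> fst d"
    and U: "open U" "snd c p \<in> U" and Ck: "\<And>k. Ck_on k U \<phi>"
    and \<phi>: "\<And>x. x \<in> W \<inter> S \<Longrightarrow> snd c x \<in> U \<Longrightarrow> \<phi> (snd c x) = snd d (F x)"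
    unfolding local_representative_def by auto
  from c d have atl: "c \<in> mfd_atlas M" "d \<in> mfd_atlas N" by (auto simp: charts_at_def)
  note \<gamma>0 = curve_at_0[OF \<gamma>]
  obtain \<delta>1 where \<delta>1: "\<delta>1 > 0" "\<gamma> ` {-\<delta>1<..<\<delta>1} \<subseteq> W \<inter> S"
    "continuous_on {-\<delta>1<..<\<delta>1} (\<lambda>t. snd c (\<gamma> t))"
    by (rule curve_at_chart_continuous[OF M \<gamma> atl(1) W])
  have "open ({-\<delta>1<..<\<delta>1} \<inter> (\<lambda>t. snd c (\<gamma> t)) -` U)"
    using \<delta>1(3) U(1) by (intro continuous_open_preimage) auto
  then have "\<forall>\<^sub>F t in nhds 0. t \<in> {-\<delta>1<..<\<delta>1} \<inter> (\<lambda>t. snd c (\<gamma> t)) -` U"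
    using \<delta>1(1) U(2) \<gamma>0 by (intro eventually_nhds_in_open) auto
  then obtain \<delta> where \<delta>: "\<delta> > 0" "\<And>t. t \<in> {-\<delta><..<\<delta>} \<Longrightarrow> t \<in> {-\<delta>1<..<\<delta>1} \<and> snd c (\<gamma> t) \<in> U"
    unfolding eventually_nhds_0_iff by auto
  have eq: "snd d (F (\<gamma> t)) = \<phi> (snd c (\<gamma> t))" and in_d: "F (\<gamma> t) \<in> fst d" if "t \<in> {-\<delta><..<\<delta>}" for t
  proof -
    have "\<gamma> t \<in> W \<inter> S" "snd c (\<gamma> t) \<in> U" using \<delta>(2)[OF that] \<delta>1(2) by blast+
    then show "snd d (F (\<gamma> t)) = \<phi> (snd c (\<gamma> t))" "F (\<gamma> t) \<in> fst d"
      using FW \<phi> by auto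
  qed
  have "continuous_on U \<phi>" using Ck[of 0] by simp
  moreover have "continuous_on {-\<delta><..<\<delta>} (\<lambda>t. snd c (\<gamma> t))"
    using \<delta>(2) by (intro continuous_on_subset[OF \<delta>1(3)]) blast
  moreover have "(\<lambda>t. snd c (\<gamma> t)) ` {-\<delta><..<\<delta>} \<subseteq> U" using \<delta>(2) by blast
  ultimately have "continuous_on {-\<delta><..<\<delta>} (\<lambda>t. \<phi> (snd c (\<gamma> t)))"
    by (rule continuous_on_compose2)
  then have "continuous_on {-\<delta><..<\<delta>} (\<lambda>t. snd d (F (\<gamma> t)))"
    by (rule continuous_on_eq) (simp add: eq)
  then have "continuous_map (top_of_set {-\<delta><..<\<delta>}) (top_of_set (snd d ` fst d)) (\<lambda>t. snd d (F (\<gamma> t)))"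
    using in_d by (auto simp: continuous_map_in_subtopology)
  from continuous_map_compose[OF this smooth_manifold_continuous_chart_inv[OF N atl(2)]]
  have cont: "continuous_map (top_of_set {-\<delta><..<\<delta>}) (mfd_top N) (F \<circ> \<gamma>)"
  proof (rule continuous_map_eq)
    fix t assume "t \<in> topspace (top_of_set {-\<delta><..<\<delta>})"
    then have "F (\<gamma> t) \<in> fst d" by (intro in_d) simp
    from chart_inv_cancel[OF smooth_manifold_continuous_charts[OF N] atl(2) this]
    show "(chart_inv d \<circ> (\<lambda>t. snd d (F (\<gamma> t)))) t = (F \<circ> \<gamma>) t" by simp
  qed
  have "\<forall>\<^sub>F t in nhds 0. snd d ((F \<circ> \<gamma>) t) = \<phi> (snd c (\<gamma> t))"
    unfolding eventually_nhds_0_iff using \<delta>(1) eq by auto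
  from has_vector_derivative_smooth_image[where \<kappa> = "\<lambda>t. snd c (\<gamma> t)",
      OF Ck U(1) _ curve_at_has_vector_derivative[OF \<gamma> c] this]
  have v: "((\<lambda>t. snd d ((F \<circ> \<gamma>) t)) has_vector_derivative
      frechet_derivative \<phi> (at (snd c p)) (velocity M \<gamma> c)) (at 0)"
    using U(2) \<gamma>0 by simp
  have F0: "(F \<circ> \<gamma>) 0 = F p" using \<gamma>0 by simp
  show "velocity N (F \<circ> \<gamma>) d = frechet_derivative \<phi> (at (snd c p)) (velocity M \<gamma> c)"
    by (rule velocity_eq[where \<gamma> = "F \<circ> \<gamma>", OF F0 d v])
  have "curve_at N (pts N) (F p) (F \<circ> \<gamma>)"
    by (rule curve_at_chartI[where \<gamma> = "F \<circ> \<gamma>", OF N d F0 \<delta>(1) cont v])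
  moreover have "\<forall>\<^sub>F t in nhds 0. (F \<circ> \<gamma>) t \<in> F ` S"
    unfolding eventually_nhds_0_iff using \<delta> \<delta>1(2) by (intro exI[of _ \<delta>]) fastforce
  ultimately show "curve_at N (F ` S) (F p) (F \<circ> \<gamma>)"
    by (rule curve_at_restrict)
qed

lemma smooth_map_on_curve:
  assumes "continuous_charts M" "smooth_manifold N" "smooth_map_on M S N F" "curve_at M S p \<gamma>"
  shows "curve_at N (F ` S) (F p) (F \<circ> \<gamma>)"
proof -
  have p: "p \<in> S"
    by (rule curve_at_in[OF assms(4)])
  obtain c d W U \<phi> where "local_representative M S N F p c d W U \<phi>"
    by (rule smooth_map_on_local_representative[OF assms(1,3) p])
  from local_representative_curve(1)[OF assms(1,2) this assms(4)] show ?thesis .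
qed

text \<open>The tangent map of \<open>F\<close> at \<open>p\<close>, written on coordinates. It is linear although the velocities
  of curves inside \<open>S\<close> need not form a linear space: the extension of \<open>F\<close> to an open set of the
  ambient space supplies the linear map.\<close>

lemma smooth_map_on_velocity:
  assumes M: "continuous_charts M" and N: "smooth_manifold N" and F: "smooth_map_on M S N F" and p: "p \<in> S"
  shows "\<exists>c D. c \<in> charts_at M p \<and> (\<forall>d. linear (D d)) \<and>
    (\<forall>\<gamma> d. curve_at M S p \<gamma> \<longrightarrow> velocity N (F \<circ> \<gamma>) d = D d (velocity M \<gamma> c))"
proof -
  obtain c d0 W U \<phi> where loc: "local_representative M S N F p c d0 W U \<phi>"
    using smooth_map_on_local_representative[OF M F p] .
  then have c: "c \<in> charts_at M p" and d0: "d0 \<in> charts_at N (F p)"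
    and \<phi>: "open U" "snd c p \<in> U" "\<And>k. Ck_on k U \<phi>"
    by (auto simp: local_representative_def)
  define D0 where "D0 = frechet_derivative \<phi> (at (snd c p))"
  have D0: "linear D0"
    using Ck_on_has_derivative[OF \<phi>(3,1,2)] has_derivative_linear unfolding D0_def by blast
  obtain D1 where D1: "\<forall>d. linear (D1 d)"
    "\<forall>S \<gamma> d. curve_at N S (F p) \<gamma> \<longrightarrow> velocity N \<gamma> d = D1 d (velocity N \<gamma> d0)"
    using velocity_transition[OF N d0] by blast
  have "linear (D1 d \<circ> D0)" for d using linear_compose[OF D0] D1(1) by blast
  moreover have "velocity N (F \<circ> \<gamma>) d = (D1 d \<circ> D0) (velocity M \<gamma> c)" if "curve_at M S p \<gamma>" for \<gamma> d
    using D1(2)[rule_format, OF local_representative_curve(1)[OF M N loc that], of d]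
      local_representative_curve(2)[OF M N loc that] by (simp add: D0_def)
  ultimately show ?thesis
    using c by (intro exI[of _ c] exI[of _ "\<lambda>d. D1 d \<circ> D0"]) blast
qed

lemma smooth_map_on_velocity_cong:
  assumes "continuous_charts M" "smooth_manifold N" "smooth_map_on M S N F"
    and "curve_at M S p \<gamma>" "curve_at M S p \<gamma>'" "velocity M \<gamma> = velocity M \<gamma>'"
  shows "velocity N (F \<circ> \<gamma>) = velocity N (F \<circ> \<gamma>')"
proof -
  have p: "p \<in> S"
    by (rule curve_at_in[OF assms(4)])
  obtain c D where D: "\<forall>\<gamma> d. curve_at M S p \<gamma> \<longrightarrow> velocity N (F \<circ> \<gamma>) d = D d (velocity M \<gamma> c)"
    using smooth_map_on_velocity[OF assms(1-3) p] by blast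
  show ?thesis
    by (rule ext) (simp add: D assms(4,5,6))
qed

text \<open>The description by \<open>THE\<close> picks out the velocity of the image of any representing curve as soon as that
  velocity does not depend on the choice of the curve.\<close>

lemma tangent_map_on_velocity:
  assumes "curve_at M S p \<gamma>"
    and "\<And>\<gamma>'. curve_at M S p \<gamma>' \<Longrightarrow> velocity M \<gamma>' = velocity M \<gamma> \<Longrightarrow>
       velocity N (F \<circ> \<gamma>') = velocity N (F \<circ> \<gamma>)"
  shows "tangent_map_on M S N F p (velocity M \<gamma>) = velocity N (F \<circ> \<gamma>)"
  unfolding tangent_map_on_def
proof (rule the_equality)
  show "\<forall>\<gamma>'. curve_at M S p \<gamma>' \<and> velocity M \<gamma>' = velocity M \<gamma> \<longrightarrow>
      velocity N (F \<circ> \<gamma>') = velocity N (F \<circ> \<gamma>)"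
    using assms(2) by simp
  show "w = velocity N (F \<circ> \<gamma>)" if "\<forall>\<gamma>'. curve_at M S p \<gamma>' \<and> velocity M \<gamma>' = velocity M \<gamma> \<longrightarrow>
      velocity N (F \<circ> \<gamma>') = w" for w
    using that assms(1) by simp
qed

lemma tangent_map_on_smooth:
  assumes "continuous_charts M" "smooth_manifold N" "smooth_map_on M S N F" "curve_at M S p \<gamma>"
  shows "tangent_map_on M S N F p (velocity M \<gamma>) = velocity N (F \<circ> \<gamma>)"
  using assms by (intro tangent_map_on_velocity smooth_map_on_velocity_cong)

section \<open>Tangent spaces\<close>

text \<open>A curve drawn in coordinates stays for a short time in the image of the chart, which is open in the model
  space, and so lifts to the manifold.\<close>

lemma curve_from_chart:
  assumes M: "smooth_manifold M" and c: "c \<in> charts_at M p"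
    and \<kappa>: "\<kappa> 0 = snd c p" "\<epsilon> > 0" "continuous_on {-\<epsilon><..<\<epsilon>} \<kappa>" "\<kappa> ` {-\<epsilon><..<\<epsilon>} \<subseteq> mfd_model M"
      "(\<kappa> has_vector_derivative v) (at 0)"
  shows "curve_at M (pts M) p (chart_inv c \<circ> \<kappa>)" (is "?curve")
    and "velocity M (chart_inv c \<circ> \<kappa>) c = v" (is "?vel")
    and "\<forall>\<^sub>F t in nhds 0. \<kappa> t \<in> snd c ` fst c" (is "?ev")
proof -
  from c have atl: "c \<in> mfd_atlas M" "p \<in> fst c" by (auto simp: charts_at_def)
  from M atl have "openin (top_of_set (mfd_model M)) (snd c ` fst c)"
    by (auto simp: smooth_manifold_def)
  then obtain Q where Q: "open Q" "snd c ` fst c = mfd_model M \<inter> Q"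
    by (auto simp: openin_open)
  have "open ({-\<epsilon><..<\<epsilon>} \<inter> \<kappa> -` Q)"
    using \<kappa>(3) Q(1) by (intro continuous_open_preimage) auto
  then have "\<forall>\<^sub>F t in nhds 0. t \<in> {-\<epsilon><..<\<epsilon>} \<inter> \<kappa> -` Q"
    using \<kappa>(1,2) Q(2) atl(2) by (intro eventually_nhds_in_open) auto
  then obtain \<delta> where \<delta>: "\<delta> > 0" "\<And>t. t \<in> {-\<delta><..<\<delta>} \<Longrightarrow> t \<in> {-\<epsilon><..<\<epsilon>} \<and> \<kappa> t \<in> Q"
    unfolding eventually_nhds_0_iff by auto
  have in_c: "\<kappa> t \<in> snd c ` fst c" if "t \<in> {-\<delta><..<\<delta>}" for t
    using \<delta>(2)[OF that] \<kappa>(4) Q(2) by auto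
  show ev: ?ev
    unfolding eventually_nhds_0_iff using \<delta>(1) in_c by blast
  have "continuous_on {-\<delta><..<\<delta>} \<kappa>"
    using \<delta>(2) by (intro continuous_on_subset[OF \<kappa>(3)]) blast
  then have "continuous_map (top_of_set {-\<delta><..<\<delta>}) (top_of_set (snd c ` fst c)) \<kappa>"
    using in_c by (auto simp: continuous_map_in_subtopology)
  from continuous_map_compose[OF this smooth_manifold_continuous_chart_inv[OF M atl(1)]]
  have cont: "continuous_map (top_of_set {-\<delta><..<\<delta>}) (mfd_top M) (chart_inv c \<circ> \<kappa>)" .
  have zero: "(chart_inv c \<circ> \<kappa>) 0 = p"
    using chart_inv_cancel[OF smooth_manifold_continuous_charts[OF M] atl] \<kappa>(1) by simp
  have v: "((\<lambda>t. snd c ((chart_inv c \<circ> \<kappa>) t)) has_vector_derivative v) (at 0)"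
  proof (rule has_vector_derivative_transform_within_open[OF \<kappa>(5), of "{-\<delta><..<\<delta>}"])
    show "\<kappa> t = snd c ((chart_inv c \<circ> \<kappa>) t)" if "t \<in> {-\<delta><..<\<delta>}" for t
      using chart_inv_in[OF in_c[OF that]] by simp
  qed (use \<delta>(1) in auto)
  show ?vel by (rule velocity_eq[where \<gamma> = "chart_inv c \<circ> \<kappa>", OF zero c v])
  show ?curve by (rule curve_at_chartI[where \<gamma> = "chart_inv c \<circ> \<kappa>", OF M c zero \<delta>(1) cont v])
qed

text \<open>The difference quotients lie in the model space, which is a closed subspace.\<close>

lemma velocity_in_model:
  assumes M: "smooth_manifold M" and c: "c \<in> charts_at M p" and \<gamma>: "curve_at M S p \<gamma>"
  shows "velocity M \<gamma> c \<in> mfd_model M"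
proof -
  from c have atl: "c \<in> mfd_atlas M" "p \<in> fst c" by (auto simp: charts_at_def)
  from M atl have op: "openin (top_of_set (mfd_model M)) (snd c ` fst c)" "openin (mfd_top M) (fst c)"
    and V: "subspace (mfd_model M)"
    by (auto simp: smooth_manifold_def)
  have sub: "snd c ` fst c \<subseteq> mfd_model M" using openin_imp_subset[OF op(1)] .
  have "((\<lambda>t. snd c (\<gamma> t)) has_vector_derivative velocity M \<gamma> c) (at 0)"
    by (rule curve_at_has_vector_derivative[OF \<gamma> c])
  then have "((\<lambda>t. (1 / \<bar>t\<bar>) *\<^sub>R (snd c (\<gamma> t) - (snd c p + t *\<^sub>R velocity M \<gamma> c))) \<longlongrightarrow> 0) (at 0)"
    using curve_at_0[OF \<gamma>] by (simp add: has_vector_derivative_def has_derivative_at2)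
  then have "(\<lambda>t. norm ((1 / \<bar>t\<bar>) *\<^sub>R (snd c (\<gamma> t) - (snd c p + t *\<^sub>R velocity M \<gamma> c)))) \<midarrow>0\<rightarrow> 0"
    (is "?f \<midarrow>0\<rightarrow> 0") by (rule tendsto_norm_zero)
  moreover have "?f t = norm ((1 / t) *\<^sub>R (snd c (\<gamma> t) - snd c p) - velocity M \<gamma> c)" (is "_ = ?g t")
    if "t \<noteq> 0" for t
  proof -
    have "(1 / t) *\<^sub>R (snd c (\<gamma> t) - snd c p) - velocity M \<gamma> c =
        (1 / t) *\<^sub>R (snd c (\<gamma> t) - (snd c p + t *\<^sub>R velocity M \<gamma> c))"
      using that by (simp add: algebra_simps)
    then show ?thesis by simp
  qed
  then have "?f \<midarrow>0\<rightarrow> 0 \<longleftrightarrow> ?g \<midarrow>0\<rightarrow> 0" by (intro LIM_cong) auto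
  ultimately have "?g \<midarrow>0\<rightarrow> 0" by (rule iffD1[rotated])
  then have lim: "((\<lambda>t. (1 / t) *\<^sub>R (snd c (\<gamma> t) - snd c p)) \<longlongrightarrow> velocity M \<gamma> c) (at 0)"
    by (rule LIM_zero_cancel[OF tendsto_norm_zero_cancel])
  have "\<forall>\<^sub>F t in nhds 0. \<gamma> t \<in> fst c \<inter> S"
    by (rule curve_at_eventually_in[OF \<gamma> op(2) atl(2)])
  then have "\<forall>\<^sub>F t in at 0. (1 / t) *\<^sub>R (snd c (\<gamma> t) - snd c p) \<in> mfd_model M"
    unfolding eventually_at_filter
    by (rule eventually_mono) (use sub atl(2) V in \<open>auto intro!: subspace_scale subspace_diff\<close>)
  then show ?thesis
    by (intro Lim_in_closed_set[OF closed_subspace[OF V] _ _ lim]) auto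
qed

lemma curve_with_chart_velocity:
  assumes M: "smooth_manifold M" and c: "c \<in> charts_at M p" and v: "v \<in> mfd_model M"
  obtains \<gamma> where "curve_at M (pts M) p \<gamma>" "velocity M \<gamma> c = v"
proof -
  from c have atl: "c \<in> mfd_atlas M" "p \<in> fst c" by (auto simp: charts_at_def)
  from M atl have op: "openin (top_of_set (mfd_model M)) (snd c ` fst c)"
    and V: "subspace (mfd_model M)"
    by (auto simp: smooth_manifold_def)
  have p: "snd c p \<in> mfd_model M" using openin_imp_subset[OF op] atl by auto
  have "((\<lambda>t. snd c p + t *\<^sub>R v) has_vector_derivative v) (at 0)"
    by (auto intro!: derivative_eq_intros)
  moreover have "(\<lambda>t. snd c p + t *\<^sub>R v) ` {-1<..<1} \<subseteq> mfd_model M"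
    using V p v by (auto intro!: subspace_add subspace_scale)
  moreover have "continuous_on {-1<..<1} (\<lambda>t. snd c p + t *\<^sub>R v)"
    by (intro continuous_intros)
  ultimately show thesis
    using curve_from_chart(1,2)[OF M c, of "\<lambda>t. snd c p + t *\<^sub>R v" 1 v]
    by (intro that[of "chart_inv c \<circ> (\<lambda>t. snd c p + t *\<^sub>R v)"]) auto
qed

lemma charts_at_nonempty:
  assumes "smooth_manifold M" "p \<in> pts M"
  obtains c where "c \<in> charts_at M p"
proof -
  from assms have "p \<in> (\<Union>c\<in>mfd_atlas M. fst c)" by (simp add: smooth_manifold_def)
  then show thesis using that by (auto simp: charts_at_def)
qed

text \<open>In one chart the tangent space is the whole model space, because straight lines lift to curves; the
  linear transition maps carry the linear combination to all other charts.\<close>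

lemma tangent_space_lincomb:
  assumes M: "smooth_manifold M" and u: "u \<in> tangent_space M p" and v: "v \<in> tangent_space M p"
  shows "(\<lambda>c. a *\<^sub>R u c + b *\<^sub>R v c) \<in> tangent_space M p"
proof -
  from u v obtain \<gamma>1 \<gamma>2 where \<gamma>: "curve_at M (pts M) p \<gamma>1" "u = velocity M \<gamma>1"
    "curve_at M (pts M) p \<gamma>2" "v = velocity M \<gamma>2" by (auto simp: tangent_space_on_def)
  have p: "p \<in> pts M" by (rule curve_at_in[OF \<gamma>(1)])
  obtain c where c: "c \<in> charts_at M p" using charts_at_nonempty[OF M p] .
  obtain D where D: "\<forall>d. linear (D d)"
    "\<forall>S \<gamma> d. curve_at M S p \<gamma> \<longrightarrow> velocity M \<gamma> d = D d (velocity M \<gamma> c)"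
    using velocity_transition[OF M c] by blast
  have "a *\<^sub>R u c + b *\<^sub>R v c \<in> mfd_model M"
    using velocity_in_model[OF M c \<gamma>(1)] velocity_in_model[OF M c \<gamma>(3)] M \<gamma>
    by (auto simp: smooth_manifold_def intro!: subspace_add subspace_scale)
  then obtain \<gamma> where \<gamma>': "curve_at M (pts M) p \<gamma>" "velocity M \<gamma> c = a *\<^sub>R u c + b *\<^sub>R v c"
    by (rule curve_with_chart_velocity[OF M c])
  have "velocity M \<gamma> d = a *\<^sub>R u d + b *\<^sub>R v d" for d
    using D(2)[rule_format, OF \<gamma>'(1), of d] D(2)[rule_format, OF \<gamma>(1), of d] D(2)[rule_format, OF \<gamma>(3), of d] D(1) \<gamma>
    by (simp add: \<gamma>'(2) linear_add linear_scale)
  then have "velocity M \<gamma> = (\<lambda>c. a *\<^sub>R u c + b *\<^sub>R v c)" by auto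
  with \<gamma>'(1) show ?thesis
    unfolding tangent_space_on_def by (intro CollectI exI[of _ \<gamma>]) simp
qed

lemma curve_at_into:
  assumes F: "smooth_map M N F" and M: "continuous_charts M" and N: "smooth_manifold N"
    and \<gamma>: "curve_at M S p \<gamma>" and S: "S \<subseteq> pts M" "F ` S \<subseteq> T"
  shows "curve_at N T (F p) (F \<circ> \<gamma>)"
proof -
  have "curve_at N (F ` pts M) (F p) (F \<circ> \<gamma>)"
    by (rule smooth_map_on_curve[OF M N F curve_at_mono[OF \<gamma> S(1)]])
  moreover have "\<forall>\<^sub>F t in nhds 0. \<gamma> t \<in> pts M \<inter> S"
    using curve_at_in[OF \<gamma>] S by (intro curve_at_eventually_in[OF \<gamma>]) auto
  then have "\<forall>\<^sub>F t in nhds 0. (F \<circ> \<gamma>) t \<in> T"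
    by (rule eventually_mono) (use S in auto)
  ultimately show ?thesis by (rule curve_at_restrict)
qed

lemma curve_at_const:
  assumes "p \<in> pts M"
  shows "curve_at M {p} p (\<lambda>_. p)" and "velocity M (\<lambda>_. p) = (\<lambda>_. 0)"
  using assms by (auto simp: curve_at_def velocity_def o_def intro!: exI[of _ "1::real"])

lemma curve_at_reverse:
  assumes \<gamma>: "curve_at M S p \<gamma>"
  shows "curve_at M S p (\<lambda>t. \<gamma> (- t))" and "velocity M (\<lambda>t. \<gamma> (- t)) = (\<lambda>c. - velocity M \<gamma> c)"
proof -
  have v: "((\<lambda>t. snd c (\<gamma> (- t))) has_vector_derivative - velocity M \<gamma> c) (at 0)"
    if c: "c \<in> charts_at M p" for c
    by (rule has_vector_derivative_reflect[OF curve_at_has_vector_derivative[OF \<gamma> c]])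
  from \<gamma> obtain \<delta> where \<delta>: "\<delta> > 0" "\<gamma> ` {-\<delta><..<\<delta>} \<subseteq> S"
      "continuous_map (top_of_set {-\<delta><..<\<delta>}) (mfd_top M) \<gamma>"
    by (auto simp: curve_at_def)
  have "continuous_map (top_of_set {-\<delta><..<\<delta>}) (top_of_set {-\<delta><..<\<delta>}) uminus"
    by (auto simp: continuous_map_in_subtopology intro!: continuous_intros)
  from continuous_map_compose[OF this \<delta>(3)]
  have "continuous_map (top_of_set {-\<delta><..<\<delta>}) (mfd_top M) (\<lambda>t. \<gamma> (- t))" by (simp add: o_def)
  moreover have "(\<lambda>t. \<gamma> (- t)) ` {-\<delta><..<\<delta>} \<subseteq> S" using \<delta>(2) by force
  moreover have "(snd c \<circ> (\<lambda>t. \<gamma> (- t))) differentiable (at 0)" if "c \<in> charts_at M p" for c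
    using differentiableI_vector[OF v[OF that]] by (simp add: o_def)
  ultimately show "curve_at M S p (\<lambda>t. \<gamma> (- t))"
    using \<delta>(1) curve_at_0[OF \<gamma>] unfolding curve_at_def by auto
  show "velocity M (\<lambda>t. \<gamma> (- t)) = (\<lambda>c. - velocity M \<gamma> c)"
  proof
    fix c
    show "velocity M (\<lambda>t. \<gamma> (- t)) c = - velocity M \<gamma> c"
    proof (cases "c \<in> charts_at M p")
      case True
      then show ?thesis
        using curve_at_0[OF \<gamma>] by (intro velocity_eq[of "\<lambda>t. \<gamma> (- t)" p]) (auto intro: v)
    qed (use curve_at_0[OF \<gamma>] in \<open>simp add: velocity_def\<close>)
  qed
qed

section \<open>Fibres of a submersion\<close>

lemma Ck_on_subset: "Ck_on k U f \<Longrightarrow> T \<subseteq> U \<Longrightarrow> Ck_on k T f"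
  by (induction k arbitrary: f) (auto intro: continuous_on_subset differentiable_on_subset)

text \<open>The level set of \<open>\<phi>\<close> in \<open>V\<close> is straightened by a map of the ambient space to itself. Let \<open>D\<close> be the
  derivative of \<open>\<phi>\<close> at \<open>v\<close> and \<open>B\<close> a linear map into \<open>V\<close> with \<open>D (B w) = w\<close> for \<open>w \<in> W\<close>. The map
  \<open>\<Psi> x = x + B (\<phi> x - \<phi> v) - B (D (x - v))\<close> has the identity as its derivative at \<open>v\<close>, so it is locally
  invertible, and the curve is the preimage of the straight line \<open>v + t X\<close>. Applying \<open>D\<close> to
  \<open>\<Psi> x = v + t X\<close> gives \<open>\<phi> x = \<phi> v\<close>, since \<open>D X = 0\<close>.\<close>

lemma level_set_curve:
  fixes \<phi> :: "'e::euclidean_space \<Rightarrow> 'f::euclidean_space"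
  assumes U: "open U" "v \<in> U" and \<phi>: "Ck_on 1 U \<phi>"
    and V: "subspace V" "v \<in> V" and W: "\<phi> ` (V \<inter> U) \<subseteq> W" "subspace W"
    and D: "frechet_derivative \<phi> (at v) ` V = W"
    and X: "X \<in> V" "frechet_derivative \<phi> (at v) X = 0"
  obtains \<epsilon> \<kappa> where "\<epsilon> > (0::real)" "continuous_on {-\<epsilon><..<\<epsilon>} \<kappa>" "\<kappa> 0 = v"
    "\<forall>t\<in>{-\<epsilon><..<\<epsilon>}. \<kappa> t \<in> V \<inter> U \<and> \<phi> (\<kappa> t) = \<phi> v"
    "(\<kappa> has_vector_derivative X) (at 0)"
proof -
  define D where "D = frechet_derivative \<phi> (at v)"
  have der: "(\<phi> has_derivative frechet_derivative \<phi> (at x)) (at x)" if "x \<in> U" for x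
    using Ck_on_has_derivative[OF \<phi> U(1) that] .
  have blin: "bounded_linear (frechet_derivative \<phi> (at x))" if "x \<in> U" for x
    using der[OF that] has_derivative_bounded_linear by blast
  have linD: "linear D" using blin[OF U(2)] bounded_linear.linear unfolding D_def by blast
  obtain B where B: "range B \<subseteq> V" "linear B" "\<And>w. w \<in> W \<Longrightarrow> D (B w) = w"
    using linear_exists_right_inverse_on[OF linD V(1)] assms(8) unfolding D_def by blast
  have blinB: "bounded_linear B" using B(2) linear_conv_bounded_linear by blast
  have blinD: "bounded_linear D" using linD linear_conv_bounded_linear by blast
  define \<Psi> where "\<Psi> x = x + B (\<phi> x - \<phi> v) - B (D (x - v))" for x
  define \<Psi>' where "\<Psi>' x = Blinfun (\<lambda>h. h + B (frechet_derivative \<phi> (at x) h) - B (D h))" for x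
  have app: "blinfun_apply (\<Psi>' x) = (\<lambda>h. h + B (frechet_derivative \<phi> (at x) h) - B (D h))" if "x \<in> U" for x
    unfolding \<Psi>'_def
    by (intro bounded_linear_Blinfun_apply bounded_linear_sub bounded_linear_add bounded_linear_ident
        bounded_linear_compose[OF blinB] blin that blinD)
  have der\<Psi>: "(\<Psi> has_derivative blinfun_apply (\<Psi>' x)) (at x)" if "x \<in> U" for x
    unfolding \<Psi>_def app[OF that]
    by (rule derivative_eq_intros bounded_linear.has_derivative[OF blinB]
        bounded_linear.has_derivative[OF blinD] der[OF that] refl)+ simp
  have cont\<Psi>: "continuous_on U \<Psi>'"
  proof (rule continuous_on_blinfun_componentwise)
    fix i :: 'e
    have "continuous_on U (\<lambda>x. frechet_derivative \<phi> (at x) i)" using \<phi> by simp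
    then have "continuous_on U (\<lambda>x. i + B (frechet_derivative \<phi> (at x) i) - B (D i))"
      by (intro continuous_intros bounded_linear.continuous_on[OF blinB])
    then show "continuous_on U (\<lambda>x. blinfun_apply (\<Psi>' x) i)"
      by (rule continuous_on_eq) (simp add: app)
  qed
  have id0: "blinfun_apply (\<Psi>' v) = id"
    using app[OF U(2)] by (auto simp: D_def)
  have \<Psi>v: "\<Psi> v = v"
    using B(2) linD by (simp add: \<Psi>_def linear_0)
  have "id_blinfun o\<^sub>L \<Psi>' v = id_blinfun"
    by (rule blinfun_eqI) (simp add: id0)
  with inverse_function_theorem[OF U(1) der\<Psi> cont\<Psi> U(2)]
  obtain U' V' g g' where "open U'" and U': "U' \<subseteq> U" "v \<in> U'" and V': "open V'" "v \<in> V'"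
    and hom: "homeomorphism U' V' \<Psi> g" and derg: "\<And>y. y \<in> V' \<Longrightarrow> (g has_derivative (g' y)) (at y)"
    and g': "\<And>y. y \<in> V' \<Longrightarrow> g' y = inv (blinfun_apply (\<Psi>' (g y)))"
    unfolding \<Psi>v by metis
  have gv: "g v = v" using hom U'(2) \<Psi>v by (metis homeomorphism_apply1)
  have "g' v = id" using g'[OF V'(2)] gv id0 by (simp add: inv_id)
  then have derg0: "(g has_derivative id) (at v)" using derg[OF V'(2)] by simp
  have "open ((\<lambda>t. v + t *\<^sub>R X) -` V')"
    by (intro open_vimage V' continuous_intros)
  then have "\<forall>\<^sub>F t in nhds 0. v + t *\<^sub>R X \<in> V'"
    using V'(2) eventually_nhds_in_open[of _ 0] by force
  then obtain \<epsilon> where \<epsilon>: "\<epsilon> > 0" "\<And>t. t \<in> {-\<epsilon><..<\<epsilon>} \<Longrightarrow> v + t *\<^sub>R X \<in> V'"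
    unfolding eventually_nhds_0_iff by blast
  show thesis
  proof
    show "\<epsilon> > 0" by fact
    have "continuous_on V' g" using hom by (simp add: homeomorphism_def)
    then show "continuous_on {-\<epsilon><..<\<epsilon>} (\<lambda>t. g (v + t *\<^sub>R X))"
      by (rule continuous_on_compose2) (use \<epsilon>(2) in \<open>auto intro!: continuous_intros\<close>)
    show "g (v + 0 *\<^sub>R X) = v" using gv by simp
    have "((\<lambda>t. v + t *\<^sub>R X) has_vector_derivative X) (at 0)"
      by (auto intro!: derivative_eq_intros)
    from vector_derivative_diff_chain_within[OF this, of g id] derg0
    show "((\<lambda>t. g (v + t *\<^sub>R X)) has_vector_derivative X) (at 0)"
      by (simp add: o_def has_derivative_at_withinI)
    show "\<forall>t\<in>{-\<epsilon><..<\<epsilon>}. g (v + t *\<^sub>R X) \<in> V \<inter> U \<and> \<phi> (g (v + t *\<^sub>R X)) = \<phi> v"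
    proof
      fix t assume "t \<in> {-\<epsilon><..<\<epsilon>}"
      then have t: "v + t *\<^sub>R X \<in> V'" by (rule \<epsilon>(2))
      define x where "x = g (v + t *\<^sub>R X)"
      have "x \<in> U'" unfolding x_def using hom t by (auto simp: homeomorphism_def)
      then have xU: "x \<in> U" using U' by blast
      have "\<Psi> x = v + t *\<^sub>R X" unfolding x_def using hom t by (auto simp: homeomorphism_def)
      then have eq: "x + B (\<phi> x - \<phi> v) - B (D (x - v)) = v + t *\<^sub>R X" by (simp add: \<Psi>_def)
      then have "x = v + t *\<^sub>R X - B (\<phi> x - \<phi> v) + B (D (x - v))" by (simp add: algebra_simps)
      moreover have "B y \<in> V" for y using B(1) by auto
      ultimately have xV: "x \<in> V"
        using V X(1) by (metis subspace_add subspace_diff subspace_scale)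
      \<comment> \<open>Both arguments of \<open>B\<close> lie in \<open>W\<close>, where \<open>D \<circ> B\<close> is the identity.\<close>
      have W1: "\<phi> x - \<phi> v \<in> W"
        using xU xV U V W by (intro subspace_diff) auto
      have W2: "D (x - v) \<in> W"
        using assms(8) xV V by (auto simp: D_def intro: subspace_diff)
      have "x - v + B (\<phi> x - \<phi> v) - B (D (x - v)) = t *\<^sub>R X" using eq by (simp add: algebra_simps)
      then have "D (x - v + B (\<phi> x - \<phi> v) - B (D (x - v))) = D (t *\<^sub>R X)" by simp
      then have "D (x - v) + (\<phi> x - \<phi> v) - D (x - v) = 0"
        using linD X(2) B(3)[OF W1] B(3)[OF W2]
        by (simp add: linear_add linear_diff linear_scale flip: D_def)
      then show "g (v + t *\<^sub>R X) \<in> V \<inter> U \<and> \<phi> (g (v + t *\<^sub>R X)) = \<phi> v"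
        using xU xV by (simp add: x_def)
    qed
  qed
qed

text \<open>Surjectivity of the tangent map makes the derivative of a coordinate expression map the model
  space of \<open>M\<close> onto that of \<open>N\<close>. Hence \<open>level_set_curve\<close> applies in coordinates, and its
  curve lifts to the fibre.\<close>

lemma submersion_kernel_curve:
  assumes M: "smooth_manifold M" and N: "smooth_manifold N" and F: "submersion M N F"
    and X: "X \<in> tangent_space M p" "tangent_map M N F p X = (\<lambda>_. 0)"
  obtains \<gamma> where "curve_at M {k \<in> pts M. F k = F p} p \<gamma>" "velocity M \<gamma> = X"
proof -
  note Mc = smooth_manifold_continuous_charts[OF M] and Nc = smooth_manifold_continuous_charts[OF N]
  from X(1) obtain \<xi> where \<xi>: "curve_at M (pts M) p \<xi>" "X = velocity M \<xi>"
    by (auto simp: tangent_space_on_def)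
  have p: "p \<in> pts M" by (rule curve_at_in[OF \<xi>(1)])
  from F have smooth: "smooth_map M N F"
    and onto: "tangent_map M N F p ` tangent_space M p = tangent_space N (F p)"
    using p by (auto simp: submersion_def)
  obtain c d Q U \<phi> where loc: "local_representative M (pts M) N F p c d Q U \<phi>"
    by (rule smooth_map_on_local_representative[OF Mc smooth p])
  then have c: "c \<in> charts_at M p" and d: "d \<in> charts_at N (F p)"
    and Q: "openin (mfd_top M) Q" "p \<in> Q" "Q \<subseteq> fst c" and FQ: "F ` (Q \<inter> pts M) \<subseteq> fst d"
    and U: "open U" "snd c p \<in> U" and Ck: "\<And>k. Ck_on k U \<phi>"
    and \<phi>: "\<And>x. x \<in> Q \<inter> pts M \<Longrightarrow> snd c x \<in> U \<Longrightarrow> \<phi> (snd c x) = snd d (F x)"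
    unfolding local_representative_def by auto
  have Qp: "Q \<subseteq> pts M" using openin_subset[OF Q(1)] .
  from c d have atl: "c \<in> mfd_atlas M" "d \<in> mfd_atlas N" "p \<in> fst c" by (auto simp: charts_at_def)
  define V where "V = mfd_model M"
  define W where "W = mfd_model N"
  define D where "D = frechet_derivative \<phi> (at (snd c p))"
  have V: "subspace V" and opc: "openin (top_of_set V) (snd c ` fst c)"
    and hc: "homeomorphic_map (subtopology (mfd_top M) (fst c)) (top_of_set (snd c ` fst c)) (snd c)"
    using M atl by (auto simp: smooth_manifold_def V_def)
  have W: "subspace W" and "openin (top_of_set W) (snd d ` fst d)"
    using N atl by (auto simp: smooth_manifold_def W_def)
  then have dW: "snd d ` fst d \<subseteq> W" using openin_imp_subset by blast
  have vel: "velocity N (F \<circ> \<gamma>) d = D (velocity M \<gamma> c)" if "curve_at M (pts M) p \<gamma>" for \<gamma>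
    unfolding D_def by (rule local_representative_curve(2)[OF Mc N loc that])
  have "openin (subtopology (mfd_top M) (fst c)) Q"
    using Q by (auto simp: openin_subtopology)
  then have "openin (top_of_set (snd c ` fst c)) (snd c ` Q)"
    using homeomorphic_imp_open_map[OF hc] by (auto simp: open_map_def)
  then have "openin (top_of_set V) (snd c ` Q)" using opc by (rule openin_trans)
  \<comment> \<open>Points of the model space in \<open>R\<close> are coordinates of points of \<open>Q\<close>, where \<open>\<phi>\<close> represents \<open>F\<close>; outside,
    \<open>\<phi>\<close> is an arbitrary extension.\<close>
  then obtain R where R: "open R" "snd c ` Q = V \<inter> R" by (auto simp: openin_open)
  have DV: "D ` V = W"
  proof
    show "D ` V \<subseteq> W"
    proof
      fix w assume "w \<in> D ` V"
      then obtain u where u: "u \<in> V" "w = D u" by blast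
      obtain \<gamma> where \<gamma>: "curve_at M (pts M) p \<gamma>" "velocity M \<gamma> c = u"
        using u(1) unfolding V_def by (rule curve_with_chart_velocity[OF M c])
      have "velocity N (F \<circ> \<gamma>) d \<in> W"
        unfolding W_def by (rule velocity_in_model[OF N d smooth_map_on_curve[OF Mc N smooth \<gamma>(1)]])
      then show "w \<in> W" using vel[OF \<gamma>(1)] \<gamma>(2) u(2) by simp
    qed
    show "W \<subseteq> D ` V"
    proof
      fix w assume "w \<in> W"
      then obtain \<eta> where \<eta>: "curve_at N (pts N) (F p) \<eta>" "velocity N \<eta> d = w"
        unfolding W_def by (rule curve_with_chart_velocity[OF N d])
      then have "velocity N \<eta> \<in> tangent_map M N F p ` tangent_space M p"
        unfolding onto by (auto simp: tangent_space_on_def)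
      then obtain \<gamma> where \<gamma>: "curve_at M (pts M) p \<gamma>"
        and "velocity N \<eta> = tangent_map M N F p (velocity M \<gamma>)"
        by (auto simp: tangent_space_on_def)
      then have "velocity N \<eta> = velocity N (F \<circ> \<gamma>)"
        using tangent_map_on_smooth[OF Mc N smooth \<gamma>] by simp
      then have "w = D (velocity M \<gamma> c)" using vel[OF \<gamma>] \<eta>(2) by simp
      moreover have "velocity M \<gamma> c \<in> V" unfolding V_def by (rule velocity_in_model[OF M c \<gamma>])
      ultimately show "w \<in> D ` V" by blast
    qed
  qed
  have Xc: "X c \<in> V" unfolding \<xi>(2) V_def by (rule velocity_in_model[OF M c \<xi>(1)])
  have DX: "D (X c) = 0"
    using vel[OF \<xi>(1)] X(2) tangent_map_on_smooth[OF Mc N smooth \<xi>(1)] \<xi>(2) by simp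
  have UR: "open (U \<inter> R)" "snd c p \<in> U \<inter> R" and cpV: "snd c p \<in> V"
    using U R Q(2) by auto
  have \<phi>V: "\<phi> ` (V \<inter> (U \<inter> R)) \<subseteq> W"
  proof
    fix w assume "w \<in> \<phi> ` (V \<inter> (U \<inter> R))"
    then obtain y where y: "y \<in> V \<inter> R" "y \<in> U" "w = \<phi> y" by auto
    from y(1) obtain x where "x \<in> Q" "y = snd c x" unfolding R(2)[symmetric] by auto
    with y have "x \<in> Q" "snd c x \<in> U" "w = \<phi> (snd c x)" by auto
    then have "w = snd d (F x)" "F x \<in> fst d" using \<phi> FQ Qp by auto
    then show "w \<in> W" using dW by blast
  qed
  obtain \<epsilon> \<kappa> where \<kappa>: "\<epsilon> > (0::real)" "continuous_on {-\<epsilon><..<\<epsilon>} \<kappa>" "\<kappa> 0 = snd c p"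
    "\<forall>t\<in>{-\<epsilon><..<\<epsilon>}. \<kappa> t \<in> V \<inter> (U \<inter> R) \<and> \<phi> (\<kappa> t) = \<phi> (snd c p)"
    "(\<kappa> has_vector_derivative X c) (at 0)"
    by (rule level_set_curve[OF UR Ck_on_subset[OF Ck Int_lower1] V cpV \<phi>V W
          DV[unfolded D_def] Xc DX[unfolded D_def]])
  define \<gamma> where "\<gamma> = chart_inv c \<circ> \<kappa>"
  have \<kappa>V: "\<kappa> ` {-\<epsilon><..<\<epsilon>} \<subseteq> mfd_model M" using \<kappa>(4) V_def by blast
  have \<gamma>: "curve_at M (pts M) p \<gamma>" "velocity M \<gamma> c = X c"
    unfolding \<gamma>_def by (rule curve_from_chart[OF M c \<kappa>(3,1,2) \<kappa>V \<kappa>(5)])+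
  have "\<gamma> t \<in> {k \<in> pts M. F k = F p}" if "t \<in> {-\<epsilon><..<\<epsilon>}" for t
  proof -
    have k: "\<kappa> t \<in> snd c ` Q" "\<kappa> t \<in> U" "\<phi> (\<kappa> t) = \<phi> (snd c p)" using \<kappa>(4)[rule_format, OF that] R(2) by auto
    then obtain x where x: "x \<in> Q" "\<kappa> t = snd c x" by auto
    then have "\<gamma> t = x" unfolding \<gamma>_def using chart_inv_cancel[OF Mc atl(1)] Q(3) by auto
    moreover have "snd d (F x) = snd d (F p)" "F x \<in> fst d" "F p \<in> fst d"
      using k x \<phi>[of x] \<phi>[of p] Q(2) U(2) Qp FQ p subsetD[OF Qp x(1)] by auto
    then have "F x = F p"
      using Nc atl(2) unfolding continuous_charts_def by (meson inj_onD)
    ultimately show ?thesis using x Qp by auto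
  qed
  then have "\<forall>\<^sub>F t in nhds 0. \<gamma> t \<in> {k \<in> pts M. F k = F p}"
    unfolding eventually_nhds_0_iff using \<kappa>(1) by blast
  from curve_at_restrict[OF \<gamma>(1) this] have "curve_at M {k \<in> pts M. F k = F p} p \<gamma>" .
  moreover have "velocity M \<gamma> = X"
    unfolding \<xi>(2) by (rule velocity_eqI[OF M c \<gamma>(1) \<xi>(1)]) (use \<gamma>(2) \<xi>(2) in simp)
  ultimately show thesis by (rule that)
qed

section \<open>Products\<close>

lemma charts_at_prod_mfd:
  assumes "k \<in> charts_at (prod_mfd M N) (a, b)"
  obtains c d where "c \<in> charts_at M a" "d \<in> charts_at N b"
    "k = (fst c \<times> fst d, map_prod (snd c) (snd d))"
  using assms by (auto simp: charts_at_def prod_mfd_def)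

lemma Pair_has_chart_derivative:
  assumes \<gamma>: "curve_at M S a \<gamma>" and \<eta>: "curve_at N T b \<eta>"
    and c: "c \<in> charts_at M a" and d: "d \<in> charts_at N b"
  shows "((\<lambda>t. map_prod (snd c) (snd d) (\<gamma> t, \<eta> t)) has_vector_derivative
     (velocity M \<gamma> c, velocity N \<eta> d)) (at 0)"
  using has_vector_derivative_Pair[OF curve_at_has_vector_derivative[OF \<gamma> c] curve_at_has_vector_derivative[OF \<eta> d]]
  by simp

lemma curve_at_Pair:
  assumes \<gamma>: "curve_at M S a \<gamma>" and \<eta>: "curve_at N T b \<eta>"
  shows "curve_at (prod_mfd M N) (S \<times> T) (a, b) (\<lambda>t. (\<gamma> t, \<eta> t))"
proof -
  from \<gamma> obtain \<delta> where \<delta>: "\<delta> > 0" "\<gamma> ` {-\<delta><..<\<delta>} \<subseteq> S"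
      "continuous_map (top_of_set {-\<delta><..<\<delta>}) (mfd_top M) \<gamma>"
    by (auto simp: curve_at_def)
  from \<eta> obtain \<epsilon> where \<epsilon>: "\<epsilon> > 0" "\<eta> ` {-\<epsilon><..<\<epsilon>} \<subseteq> T"
      "continuous_map (top_of_set {-\<epsilon><..<\<epsilon>}) (mfd_top N) \<eta>"
    by (auto simp: curve_at_def)
  define r where "r = min \<delta> \<epsilon>"
  have "continuous_map (top_of_set {-r<..<r}) (mfd_top M) \<gamma>"
    by (rule continuous_map_from_subtopology_mono[OF \<delta>(3)]) (auto simp: r_def)
  moreover have "continuous_map (top_of_set {-r<..<r}) (mfd_top N) \<eta>"
    by (rule continuous_map_from_subtopology_mono[OF \<epsilon>(3)]) (auto simp: r_def)
  ultimately have cont: "continuous_map (top_of_set {-r<..<r}) (mfd_top (prod_mfd M N)) (\<lambda>t. (\<gamma> t, \<eta> t))"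
    by (simp add: prod_mfd_def continuous_map_pairwise o_def)
  have r: "r > 0" "(\<lambda>t. (\<gamma> t, \<eta> t)) ` {-r<..<r} \<subseteq> S \<times> T"
  proof -
    have "{-r<..<r} \<subseteq> {-\<delta><..<\<delta>}" "{-r<..<r} \<subseteq> {-\<epsilon><..<\<epsilon>}" by (auto simp: r_def)
    then show "(\<lambda>t. (\<gamma> t, \<eta> t)) ` {-r<..<r} \<subseteq> S \<times> T" using \<delta>(2) \<epsilon>(2) by blast
  qed (use \<delta>(1) \<epsilon>(1) in \<open>simp add: r_def\<close>)
  have "(snd k \<circ> (\<lambda>t. (\<gamma> t, \<eta> t))) differentiable (at 0)"
    if k_in: "k \<in> charts_at (prod_mfd M N) (a, b)" for k
  proof -
    obtain c d where cd: "c \<in> charts_at M a" "d \<in> charts_at N b" and k: "k = (fst c \<times> fst d, map_prod (snd c) (snd d))"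
      by (rule charts_at_prod_mfd[OF k_in])
    from differentiableI_vector[OF Pair_has_chart_derivative[OF \<gamma> \<eta> cd]]
    show ?thesis by (simp add: o_def k)
  qed
  with cont r curve_at_0[OF \<gamma>] curve_at_0[OF \<eta>] show ?thesis
    unfolding curve_at_def by blast
qed

lemma velocity_Pair:
  assumes \<gamma>: "curve_at M S a \<gamma>" and \<eta>: "curve_at N T b \<eta>"
    and c: "c \<in> charts_at M a" and d: "d \<in> charts_at N b"
  shows "velocity (prod_mfd M N) (\<lambda>t. (\<gamma> t, \<eta> t)) (fst c \<times> fst d, map_prod (snd c) (snd d)) =
     (velocity M \<gamma> c, velocity N \<eta> d)"
proof -
  have "(fst c \<times> fst d, map_prod (snd c) (snd d)) \<in> charts_at (prod_mfd M N) (a, b)"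
    using c d unfolding charts_at_def prod_mfd_def mfd.simps by fastforce
  moreover have "((\<lambda>t. snd (fst c \<times> fst d, map_prod (snd c) (snd d)) (\<gamma> t, \<eta> t)) has_vector_derivative
     (velocity M \<gamma> c, velocity N \<eta> d)) (at 0)"
    using Pair_has_chart_derivative[OF \<gamma> \<eta> c d] by simp
  ultimately show ?thesis
    using curve_at_0[OF \<gamma>] curve_at_0[OF \<eta>] by (intro velocity_eq[of "\<lambda>t. (\<gamma> t, \<eta> t)" "(a, b)"]) auto
qed

section \<open>Real functions\<close>

lemma smooth_manifold_euclidean: "smooth_manifold euclidean_mfd"
proof -
  have "second_countable (euclidean :: 'a topology)"
  proof -
    obtain \<B> :: "'a set set" where "countable \<B>" "\<And>C. C \<in> \<B> \<Longrightarrow> open C"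
      "\<And>S. open S \<Longrightarrow> \<exists>U. U \<subseteq> \<B> \<and> S = \<Union>U"
      using univ_second_countable by metis
    then show ?thesis
      unfolding second_countable_def open_openin[symmetric] by (intro exI[of _ \<B>]) fast
  qed
  moreover have "smooth_on UNIV (id :: 'a \<Rightarrow> 'a)"
    unfolding smooth_on_def id_def using Ck_on_id by (intro ballI exI[of _ UNIV] exI[of _ "\<lambda>x. x"]) auto
  moreover have "chart_inv (UNIV, id) = (id :: 'a \<Rightarrow> 'a)"
    by (auto simp: chart_inv_def fun_eq_iff inv_f_f)
  ultimately show ?thesis
    by (simp add: smooth_manifold_def euclidean_mfd_def Hausdorff_space_euclidean homeomorphic_map_id)
qed

lemma velocity_euclidean:
  "velocity euclidean_mfd \<gamma> = (\<lambda>c. if c = (UNIV, id) then vector_derivative \<gamma> (at 0) else 0)"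
  by (auto simp: velocity_def charts_at_def euclidean_mfd_def fun_eq_iff o_def)

lemma differential_on_velocity:
  assumes "curve_at M S p \<gamma>"
    and "\<And>\<gamma>'. curve_at M S p \<gamma>' \<Longrightarrow> velocity M \<gamma>' = velocity M \<gamma> \<Longrightarrow>
       vector_derivative (\<lambda>t. f (\<gamma>' t)) (at 0) = vector_derivative (\<lambda>t. f (\<gamma> t)) (at 0)"
  shows "differential_on M S f p (velocity M \<gamma>) = vector_derivative (\<lambda>t. f (\<gamma> t)) (at 0)"
proof -
  have "tangent_map_on M S euclidean_mfd f p (velocity M \<gamma>) = velocity euclidean_mfd (f \<circ> \<gamma>)"
    using assms(2) by (intro tangent_map_on_velocity[OF assms(1)]) (auto simp: velocity_euclidean o_def)
  then show ?thesis by (simp add: differential_on_def velocity_euclidean o_def)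
qed

text \<open>Functions with values in the real line are read off in its only chart; the linear form is kept explicit
  because the differential has to be shown to be an element of the dual space.\<close>

lemma smooth_function_velocity:
  assumes M: "smooth_manifold M" and f: "smooth_map M euclidean_mfd f" and p: "p \<in> pts M"
  shows "\<exists>c D. c \<in> charts_at M p \<and> linear D \<and> (\<forall>\<gamma>. curve_at M (pts M) p \<gamma> \<longrightarrow>
     ((\<lambda>t. f (\<gamma> t)) has_vector_derivative D (velocity M \<gamma> c)) (at 0))"
proof -
  note Mc = smooth_manifold_continuous_charts[OF M]
  obtain c D where c: "c \<in> charts_at M p" and D: "\<forall>d. linear (D d)"
    "\<forall>\<gamma> d. curve_at M (pts M) p \<gamma> \<longrightarrow> velocity euclidean_mfd (f \<circ> \<gamma>) d = D d (velocity M \<gamma> c)"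
    using smooth_map_on_velocity[OF Mc smooth_manifold_euclidean f p] by blast
  have "((\<lambda>t. f (\<gamma> t)) has_vector_derivative D (UNIV, id) (velocity M \<gamma> c)) (at 0)"
    if \<gamma>: "curve_at M (pts M) p \<gamma>" for \<gamma>
  proof -
    have "(UNIV, id) \<in> charts_at euclidean_mfd (f p)"
      by (simp add: charts_at_def euclidean_mfd_def)
    from curve_at_has_vector_derivative[OF smooth_map_on_curve[OF Mc smooth_manifold_euclidean f \<gamma>] this] D(2) \<gamma>
    show ?thesis by simp
  qed
  with c D show ?thesis by blast
qed

lemma differential_velocity:
  assumes M: "smooth_manifold M" and f: "smooth_map M euclidean_mfd f" and \<gamma>: "curve_at M (pts M) p \<gamma>"
  shows "((\<lambda>t. f (\<gamma> t)) has_vector_derivative differential_on M (pts M) f p (velocity M \<gamma>)) (at 0)"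
proof -
  obtain c D where D: "\<forall>\<gamma>. curve_at M (pts M) p \<gamma> \<longrightarrow>
     ((\<lambda>t. f (\<gamma> t)) has_vector_derivative D (velocity M \<gamma> c)) (at 0)"
    using smooth_function_velocity[OF M f curve_at_in[OF \<gamma>]] by blast
  have vd: "vector_derivative (\<lambda>t. f (\<eta> t)) (at 0) = D (velocity M \<eta> c)" if "curve_at M (pts M) p \<eta>" for \<eta>
    using D that by (simp add: vector_derivative_at)
  have "differential_on M (pts M) f p (velocity M \<gamma>) = vector_derivative (\<lambda>t. f (\<gamma> t)) (at 0)"
    by (rule differential_on_velocity[OF \<gamma>]) (simp add: vd \<gamma>)
  with D \<gamma> vd[OF \<gamma>] show ?thesis by simp
qed

lemma d_section_in_cotangent_bundle:
  assumes M: "smooth_manifold M" and f: "smooth_map M euclidean_mfd f" and p: "p \<in> pts M"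
  shows "d_section M f p \<in> cotangent_bundle M"
proof -
  obtain c D where D: "linear D" "\<forall>\<gamma>. curve_at M (pts M) p \<gamma> \<longrightarrow>
     ((\<lambda>t. f (\<gamma> t)) has_vector_derivative D (velocity M \<gamma> c)) (at 0)"
    using smooth_function_velocity[OF M f p] by blast
  have dif: "differential_on M (pts M) f p v = D (v c)" if v: "v \<in> tangent_space M p" for v
  proof -
    from v obtain \<gamma> where \<gamma>: "v = velocity M \<gamma>" "curve_at M (pts M) p \<gamma>"
      by (auto simp: tangent_space_on_def)
    show ?thesis
      using D(2) differential_velocity[OF M f \<gamma>(2)] \<gamma> vector_derivative_unique_at by blast
  qed
  have "restrict (differential_on M (pts M) f p) (tangent_space M p) \<in> dual_space (tangent_space M p)"
    unfolding dual_space_def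
    using D(1) by (auto simp: dif tangent_space_lincomb[OF M] linear_add linear_scale)
  then show ?thesis using p by (simp add: d_section_def cotangent_bundle_def)
qed

section \<open>Translations and inversion of a Lie groupoid\<close>

locale Lie_groupoid =
  fixes \<Gamma> :: "('g, 'e::euclidean_space, 'm, 'f::euclidean_space) groupoid"
  assumes lie: "lie_groupoid \<Gamma>"
begin

abbreviation "G \<equiv> arrows \<Gamma>"
abbreviation "m \<equiv> mult \<Gamma>"
abbreviation "e \<equiv> ident \<Gamma>"

lemma G_manifold: "smooth_manifold G" and M_manifold: "smooth_manifold (objects \<Gamma>)"
  and src_submersion: "submersion G (objects \<Gamma>) (src \<Gamma>)"
  and tgt_submersion: "submersion G (objects \<Gamma>) (tgt \<Gamma>)"
  and ident_smooth: "smooth_map (objects \<Gamma>) G e"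
  and inver_smooth: "smooth_map G G (inver \<Gamma>)"
  and mult_smooth: "smooth_map_on (prod_mfd G G) (composable \<Gamma>) G (\<lambda>(g, h). m g h)"
  using lie by (auto simp: lie_groupoid_def)

lemma G_charts: "continuous_charts G"
  by (rule smooth_manifold_continuous_charts[OF G_manifold])

lemma tgt_in: "g \<in> pts G \<Longrightarrow> tgt \<Gamma> g \<in> pts (objects \<Gamma>)"
  using tgt_submersion by (auto simp: submersion_def smooth_map_on_def)

lemma src_in: "g \<in> pts G \<Longrightarrow> src \<Gamma> g \<in> pts (objects \<Gamma>)"
  using src_submersion by (auto simp: submersion_def smooth_map_on_def)

lemma ident_in: "x \<in> pts (objects \<Gamma>) \<Longrightarrow> e x \<in> pts G"
  using ident_smooth by (auto simp: smooth_map_on_def)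

lemma inver_in: "g \<in> pts G \<Longrightarrow> inver \<Gamma> g \<in> pts G"
  using inver_smooth by (auto simp: smooth_map_on_def)

lemma src_ident: "x \<in> pts (objects \<Gamma>) \<Longrightarrow> src \<Gamma> (e x) = x"
  and tgt_ident: "x \<in> pts (objects \<Gamma>) \<Longrightarrow> tgt \<Gamma> (e x) = x"
  and src_inver: "g \<in> pts G \<Longrightarrow> src \<Gamma> (inver \<Gamma> g) = tgt \<Gamma> g"
  and tgt_inver: "g \<in> pts G \<Longrightarrow> tgt \<Gamma> (inver \<Gamma> g) = src \<Gamma> g"
  and ident_mult: "g \<in> pts G \<Longrightarrow> m (e (src \<Gamma> g)) g = g"
  and mult_ident: "g \<in> pts G \<Longrightarrow> m g (e (tgt \<Gamma> g)) = g"
  and mult_inver: "g \<in> pts G \<Longrightarrow> m g (inver \<Gamma> g) = e (src \<Gamma> g)"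
  and inver_mult: "g \<in> pts G \<Longrightarrow> m (inver \<Gamma> g) g = e (tgt \<Gamma> g)"
  using lie by (auto simp: lie_groupoid_def)

text \<open>Both sides equal the product of \<open>e x\<close> with its inverse.\<close>

lemma inver_ident:
  assumes x: "x \<in> pts (objects \<Gamma>)"
  shows "inver \<Gamma> (e x) = e x"
proof -
  have "m (e x) (inver \<Gamma> (e x)) = inver \<Gamma> (e x)"
    using ident_mult[OF inver_in[OF ident_in[OF x]]] by (simp add: src_inver tgt_ident ident_in x)
  then show ?thesis
    using mult_inver[OF ident_in[OF x]] by (simp add: src_ident x)
qed

lemma fibre_subset: "src_fibre \<Gamma> x \<subseteq> pts G" "tgt_fibre \<Gamma> x \<subseteq> pts G"
  by (auto simp: src_fibre_def tgt_fibre_def)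

lemma fibres_composable: "tgt_fibre \<Gamma> x \<times> src_fibre \<Gamma> x \<subseteq> composable \<Gamma>"
  by (auto simp: src_fibre_def tgt_fibre_def composable_def)

lemma ident_in_fibre:
  "x \<in> pts (objects \<Gamma>) \<Longrightarrow> e x \<in> src_fibre \<Gamma> x \<and> e x \<in> tgt_fibre \<Gamma> x"
  by (simp add: src_fibre_def tgt_fibre_def ident_in src_ident tgt_ident)

lemma algebroid_fibre_curve:
  assumes x: "x \<in> pts (objects \<Gamma>)" and X: "X \<in> algebroid_fibre \<Gamma> x"
  obtains \<gamma> where "curve_at G (src_fibre \<Gamma> x) (e x) \<gamma>" "velocity G \<gamma> = X"
proof -
  from X have "X \<in> tangent_space G (e x)" "tangent_map G (objects \<Gamma>) (src \<Gamma>) (e x) X = (\<lambda>_. 0)"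
    by (auto simp: algebroid_fibre_def)
  then obtain \<gamma> where \<gamma>: "curve_at G {k \<in> pts G. src \<Gamma> k = src \<Gamma> (e x)} (e x) \<gamma>" "velocity G \<gamma> = X"
    by (rule submersion_kernel_curve[OF G_manifold M_manifold src_submersion])
  from \<gamma>(1) have "curve_at G (src_fibre \<Gamma> x) (e x) \<gamma>" by (simp add: src_fibre_def src_ident x)
  then show thesis using \<gamma>(2) by (rule that)
qed

lemma mult_curve:
  assumes ST: "S \<times> T \<subseteq> composable \<Gamma>" and \<gamma>: "curve_at G S a \<gamma>" and \<eta>: "curve_at G T b \<eta>"
  shows "curve_at G (pts G) (m a b) (\<lambda>t. m (\<gamma> t) (\<eta> t))"
proof -
  have im: "(\<lambda>(g, h). m g h) ` composable \<Gamma> \<subseteq> pts G"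
    using mult_smooth by (auto simp: smooth_map_on_def)
  have "curve_at (prod_mfd G G) (composable \<Gamma>) (a, b) (\<lambda>t. (\<gamma> t, \<eta> t))"
    by (rule curve_at_mono[OF curve_at_Pair[OF \<gamma> \<eta>] ST])
  from curve_at_mono[OF smooth_map_on_curve[OF continuous_charts_prod_mfd[OF G_charts G_charts] G_manifold mult_smooth this] im]
  show ?thesis by (simp add: o_def)
qed

text \<open>The additivity of the tangent map of the multiplication is contained in the linearity of \<open>D\<close> on pairs.\<close>

lemma mult_velocity:
  assumes ST: "S \<times> T \<subseteq> composable \<Gamma>" and ab: "a \<in> S" "b \<in> T"
  shows "\<exists>c d D. (\<forall>k. linear (D k)) \<and> (\<forall>\<gamma> \<eta> k. curve_at G S a \<gamma> \<longrightarrow> curve_at G T b \<eta> \<longrightarrow>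
      velocity G (\<lambda>t. m (\<gamma> t) (\<eta> t)) k = D k (velocity G \<gamma> c, velocity G \<eta> d))"
proof -
  from ST ab have comp: "(a, b) \<in> composable \<Gamma>" by blast
  obtain cd D where cd: "cd \<in> charts_at (prod_mfd G G) (a, b)" and lin: "\<forall>d. linear (D d)"
    and D: "\<forall>\<zeta> k. curve_at (prod_mfd G G) (composable \<Gamma>) (a, b) \<zeta> \<longrightarrow>
      velocity G ((\<lambda>(g, h). m g h) \<circ> \<zeta>) k = D k (velocity (prod_mfd G G) \<zeta> cd)"
    using smooth_map_on_velocity[OF continuous_charts_prod_mfd[OF G_charts G_charts] G_manifold mult_smooth comp] by blast
  obtain c d where c: "c \<in> charts_at G a" and d: "d \<in> charts_at G b"
    and k: "cd = (fst c \<times> fst d, map_prod (snd c) (snd d))"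
    by (rule charts_at_prod_mfd[OF cd])
  have "velocity G (\<lambda>t. m (\<gamma> t) (\<eta> t)) k' = D k' (velocity G \<gamma> c, velocity G \<eta> d)"
    if \<gamma>: "curve_at G S a \<gamma>" and \<eta>: "curve_at G T b \<eta>" for \<gamma> \<eta> k'
  proof -
    have \<zeta>: "curve_at (prod_mfd G G) (composable \<Gamma>) (a, b) (\<lambda>t. (\<gamma> t, \<eta> t))"
      by (rule curve_at_mono[OF curve_at_Pair[OF \<gamma> \<eta>] ST])
    show ?thesis
      using D[rule_format, OF \<zeta>, of k'] velocity_Pair[OF \<gamma> \<eta> c d] by (simp add: o_def k)
  qed
  with lin have "(\<forall>k. linear (D k)) \<and> (\<forall>\<gamma> \<eta> k. curve_at G S a \<gamma> \<longrightarrow> curve_at G T b \<eta> \<longrightarrow>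
      velocity G (\<lambda>t. m (\<gamma> t) (\<eta> t)) k = D k (velocity G \<gamma> c, velocity G \<eta> d))"
    by blast
  then show ?thesis by iprover
qed

lemma mult_velocity_cong:
  assumes ST: "S \<times> T \<subseteq> composable \<Gamma>"
    and \<gamma>: "curve_at G S a \<gamma>" "curve_at G S a \<gamma>'" "velocity G \<gamma>' = velocity G \<gamma>"
    and \<eta>: "curve_at G T b \<eta>" "curve_at G T b \<eta>'" "velocity G \<eta>' = velocity G \<eta>"
  shows "velocity G (\<lambda>t. m (\<gamma>' t) (\<eta>' t)) = velocity G (\<lambda>t. m (\<gamma> t) (\<eta> t))"
proof -
  obtain c d D where "\<forall>\<gamma> \<eta> k. curve_at G S a \<gamma> \<longrightarrow> curve_at G T b \<eta> \<longrightarrow>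
      velocity G (\<lambda>t. m (\<gamma> t) (\<eta> t)) k = D k (velocity G \<gamma> c, velocity G \<eta> d)"
    using mult_velocity[OF ST curve_at_in[OF \<gamma>(1)] curve_at_in[OF \<eta>(1)]] by blast
  note D = this[rule_format]
  show ?thesis
    by (rule ext) (simp only: D[OF \<gamma>(1) \<eta>(1)] D[OF \<gamma>(2) \<eta>(2)] \<gamma>(3) \<eta>(3))
qed

lemma inver_curve:
  assumes x: "x \<in> pts (objects \<Gamma>)" and \<gamma>: "curve_at G (src_fibre \<Gamma> x) (e x) \<gamma>"
  shows "curve_at G (tgt_fibre \<Gamma> x) (e x) (\<lambda>t. inver \<Gamma> (\<gamma> t))"
proof -
  have "inver \<Gamma> ` src_fibre \<Gamma> x \<subseteq> tgt_fibre \<Gamma> x"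
    by (auto simp: src_fibre_def tgt_fibre_def inver_in tgt_inver)
  from curve_at_into[OF inver_smooth G_charts G_manifold \<gamma> fibre_subset(1) this] show ?thesis
    by (simp add: inver_ident x o_def)
qed

text \<open>The infinitesimal form of \<open>i(k) k = \<epsilon>(\<beta>(k))\<close>. The pair of velocities of \<open>i(\<gamma>(t))\<close> and \<open>\<gamma>(t)\<close> splits
  as a sum of two pairs with one entry zero. These belong to the pairs of curves in which one of the two is
  constantly the unit \<open>e x\<close>, and for them the product is the other curve.\<close>

lemma inver_velocity:
  assumes x: "x \<in> pts (objects \<Gamma>)" and \<gamma>: "curve_at G (src_fibre \<Gamma> x) (e x) \<gamma>"
  shows "velocity G (\<lambda>t. inver \<Gamma> (\<gamma> t)) k + velocity G \<gamma> k = velocity G (\<lambda>t. e (tgt \<Gamma> (\<gamma> t))) k"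
proof -
  note \<iota> = inver_curve[OF x \<gamma>]
  let ?\<iota> = "\<lambda>t. inver \<Gamma> (\<gamma> t)"
  obtain c d D where lin: "\<forall>k. linear (D k)"
    and D: "\<forall>\<gamma> \<eta> k. curve_at G (tgt_fibre \<Gamma> x) (e x) \<gamma> \<longrightarrow> curve_at G (src_fibre \<Gamma> x) (e x) \<eta> \<longrightarrow>
      velocity G (\<lambda>t. m (\<gamma> t) (\<eta> t)) k = D k (velocity G \<gamma> c, velocity G \<eta> d)"
    using mult_velocity[OF fibres_composable curve_at_in[OF \<iota>] curve_at_in[OF \<gamma>]] by blast
  note vm = D[rule_format]
  have const: "curve_at G (src_fibre \<Gamma> x) (e x) (\<lambda>_. e x)" "curve_at G (tgt_fibre \<Gamma> x) (e x) (\<lambda>_. e x)"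
    using curve_at_mono[OF curve_at_const(1)[OF ident_in[OF x]]] ident_in_fibre[OF x] by auto
  have const0: "velocity G (\<lambda>_. e x) = (\<lambda>_. 0)"
    by (rule curve_at_const(2)[OF ident_in[OF x]])
  have \<gamma>_in: "\<forall>\<^sub>F t in nhds 0. \<gamma> t \<in> src_fibre \<Gamma> x"
    using curve_at_eventually_in[OF \<gamma> openin_topspace ident_in[OF x]] by (rule eventually_mono) simp
  have vm1: "velocity G (\<lambda>t. e (tgt \<Gamma> (\<gamma> t))) = velocity G (\<lambda>t. m (?\<iota> t) (\<gamma> t))"
    by (rule velocity_cong, use \<gamma>_in in \<open>rule eventually_mono\<close>)
      (simp add: src_fibre_def inver_mult)
  have vm2: "velocity G ?\<iota> = velocity G (\<lambda>t. m (?\<iota> t) (e x))"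
    by (rule velocity_cong, use \<gamma>_in in \<open>rule eventually_mono\<close>)
      (use mult_ident[OF inver_in] in \<open>auto simp: src_fibre_def tgt_inver\<close>)
  have vm3: "velocity G \<gamma> = velocity G (\<lambda>t. m (e x) (\<gamma> t))"
    by (rule velocity_cong, use \<gamma>_in in \<open>rule eventually_mono\<close>)
      (use ident_mult in \<open>auto simp: src_fibre_def\<close>)
  have add: "D k (velocity G ?\<iota> c, velocity G \<gamma> d) =
      D k (velocity G ?\<iota> c, 0) + D k (0, velocity G \<gamma> d)"
    using linear_add[OF lin[rule_format, of k], of "(velocity G ?\<iota> c, 0)" "(0, velocity G \<gamma> d)"] by simp
  have "velocity G ?\<iota> k = D k (velocity G ?\<iota> c, 0)"
    using fun_cong[OF vm2, of k] vm[OF \<iota> const(1), of k] by (simp add: const0)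
  moreover have "velocity G \<gamma> k = D k (0, velocity G \<gamma> d)"
    using fun_cong[OF vm3, of k] vm[OF const(2) \<gamma>, of k] by (simp add: const0)
  ultimately have "velocity G ?\<iota> k + velocity G \<gamma> k = D k (velocity G ?\<iota> c, 0) + D k (0, velocity G \<gamma> d)"
    by (rule arg_cong2[where f = "(+)"])
  also have "\<dots> = D k (velocity G ?\<iota> c, velocity G \<gamma> d)" by (rule add[symmetric])
  also have "\<dots> = velocity G (\<lambda>t. m (?\<iota> t) (\<gamma> t)) k" by (rule vm[OF \<iota> \<gamma>, symmetric])
  also have "\<dots> = velocity G (\<lambda>t. e (tgt \<Gamma> (\<gamma> t))) k" by (rule fun_cong[OF vm1, symmetric])
  finally show ?thesis .
qed

lemma cot_tgt_d_section:
  assumes L: "smooth_map G euclidean_mfd L" and g: "g \<in> pts G"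
    and \<gamma>: "curve_at G (src_fibre \<Gamma> (tgt \<Gamma> g)) (e (tgt \<Gamma> g)) \<gamma>"
    and X: "velocity G \<gamma> \<in> algebroid_fibre \<Gamma> (tgt \<Gamma> g)"
  shows "((\<lambda>t. L (m g (\<gamma> t))) has_vector_derivative
    snd (cot_tgt \<Gamma> (d_section G L g)) (velocity G \<gamma>)) (at 0)"
proof -
  let ?S = "src_fibre \<Gamma> (tgt \<Gamma> g)"
  have ST: "{g} \<times> ?S \<subseteq> composable \<Gamma>"
    using g by (auto simp: composable_def src_fibre_def)
  have "tangent_map_on G ?S G (ltrans \<Gamma> g) (e (tgt \<Gamma> g)) (velocity G \<gamma>) = velocity G (ltrans \<Gamma> g \<circ> \<gamma>)"
    using mult_velocity_cong[OF ST curve_at_const(1)[OF g] curve_at_const(1)[OF g] refl \<gamma>]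
    by (intro tangent_map_on_velocity[OF \<gamma>]) (auto simp: ltrans_def o_def)
  moreover have cv: "curve_at G (pts G) g (\<lambda>t. m g (\<gamma> t))"
    using mult_curve[OF ST curve_at_const(1)[OF g] \<gamma>] by (simp add: mult_ident g)
  then have "velocity G (\<lambda>t. m g (\<gamma> t)) \<in> tangent_space G g"
    unfolding tangent_space_on_def by blast
  ultimately have "snd (cot_tgt \<Gamma> (d_section G L g)) (velocity G \<gamma>) =
      differential_on G (pts G) L g (velocity G (\<lambda>t. m g (\<gamma> t)))"
    using X by (simp add: cot_tgt_def d_section_def ltrans_def o_def)
  with differential_velocity[OF G_manifold L cv] show ?thesis by simp
qed

text \<open>By \<open>inver_velocity\<close>, the vector to which right translation is applied is the velocity of \<open>i(\<gamma>(-t))\<close>; the reversal of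
  time is the origin of the minus sign.\<close>

lemma cot_src_d_section:
  assumes L: "smooth_map G euclidean_mfd L" and h: "h \<in> pts G"
    and \<gamma>: "curve_at G (src_fibre \<Gamma> (src \<Gamma> h)) (e (src \<Gamma> h)) \<gamma>"
    and X: "velocity G \<gamma> \<in> algebroid_fibre \<Gamma> (src \<Gamma> h)"
  shows "((\<lambda>t. L (m (inver \<Gamma> (\<gamma> t)) h)) has_vector_derivative
    - snd (cot_src \<Gamma> (d_section G L h)) (velocity G \<gamma>)) (at 0)"
proof -
  let ?x = "src \<Gamma> h"
  let ?T = "tgt_fibre \<Gamma> ?x"
  note x = src_in[OF h]
  have ST: "?T \<times> {h} \<subseteq> composable \<Gamma>"
    using h by (auto simp: composable_def tgt_fibre_def)
  have \<gamma>p: "curve_at G (pts G) (e ?x) \<gamma>"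
    by (rule curve_at_mono[OF \<gamma> fibre_subset(1)])
  note \<iota> = inver_curve[OF x \<gamma>]
  \<comment> \<open>The time reversal turns \<open>- Ti Y\<close> into the velocity of a curve in the target fibre.\<close>
  define \<rho> where "\<rho> t = inver \<Gamma> (\<gamma> (- t))" for t
  have \<rho>: "curve_at G ?T (e ?x) \<rho>" and v\<rho>: "velocity G \<rho> = (\<lambda>c. - velocity G (\<lambda>t. inver \<Gamma> (\<gamma> t)) c)"
    using curve_at_reverse[OF \<iota>] unfolding \<rho>_def by simp_all
  have "tangent_map G G (e \<circ> tgt \<Gamma>) (e ?x) (velocity G \<gamma>) = velocity G ((e \<circ> tgt \<Gamma>) \<circ> \<gamma>)"
  proof (rule tangent_map_on_velocity[OF \<gamma>p])
    fix \<gamma>' assume \<gamma>': "curve_at G (pts G) (e ?x) \<gamma>'" "velocity G \<gamma>' = velocity G \<gamma>"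
    have smt: "smooth_map G (objects \<Gamma>) (tgt \<Gamma>)" using tgt_submersion by (simp add: submersion_def)
    have im: "tgt \<Gamma> ` pts G \<subseteq> pts (objects \<Gamma>)" using tgt_in by blast
    note Mc = smooth_manifold_continuous_charts[OF M_manifold]
    have "velocity (objects \<Gamma>) (tgt \<Gamma> \<circ> \<gamma>') = velocity (objects \<Gamma>) (tgt \<Gamma> \<circ> \<gamma>)"
      by (rule smooth_map_on_velocity_cong[OF G_charts M_manifold smt \<gamma>'(1) \<gamma>p \<gamma>'(2)])
    from smooth_map_on_velocity_cong[OF Mc G_manifold ident_smooth
        curve_at_mono[OF smooth_map_on_curve[OF G_charts M_manifold smt \<gamma>'(1)] im]
        curve_at_mono[OF smooth_map_on_curve[OF G_charts M_manifold smt \<gamma>p] im] this]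
    show "velocity G ((e \<circ> tgt \<Gamma>) \<circ> \<gamma>') = velocity G ((e \<circ> tgt \<Gamma>) \<circ> \<gamma>)" by (simp add: o_assoc)
  qed
  then have "velocity G \<gamma> - tangent_map G G (e \<circ> tgt \<Gamma>) (e ?x) (velocity G \<gamma>) = velocity G \<rho>"
    using inver_velocity[OF x \<gamma>] by (auto simp: fun_eq_iff v\<rho> o_def algebra_simps simp flip: inver_velocity[OF x \<gamma>])
  moreover have "tangent_map_on G ?T G (rtrans \<Gamma> h) (e ?x) (velocity G \<rho>) = velocity G (rtrans \<Gamma> h \<circ> \<rho>)"
    using mult_velocity_cong[OF ST \<rho> _ _ curve_at_const(1)[OF h] curve_at_const(1)[OF h] refl]
    by (intro tangent_map_on_velocity[OF \<rho>]) (auto simp: rtrans_def o_def)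
  moreover have cv: "curve_at G (pts G) h (\<lambda>t. m (\<rho> t) h)"
    using mult_curve[OF ST \<rho> curve_at_const(1)[OF h]] by (simp add: ident_mult h)
  then have "velocity G (\<lambda>t. m (\<rho> t) h) \<in> tangent_space G h"
    unfolding tangent_space_on_def by blast
  ultimately have "snd (cot_src \<Gamma> (d_section G L h)) (velocity G \<gamma>) =
      differential_on G (pts G) L h (velocity G (\<lambda>t. m (\<rho> t) h))"
    using X by (simp add: cot_src_def d_section_def rtrans_def o_def)
  with differential_velocity[OF G_manifold L cv]
  have "((\<lambda>t. L (m (\<rho> t) h)) has_vector_derivative
      snd (cot_src \<Gamma> (d_section G L h)) (velocity G \<gamma>)) (at 0)" by simp
  from has_vector_derivative_reflect[OF this] show ?thesis by (simp add: \<rho>_def)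
qed

text \<open>The differential of the sum is the difference of the two functionals. Both are extensional on the
  algebroid fibre, so they agree there exactly when they are equal.\<close>

lemma discrete_EL_iff:
  assumes L: "smooth_map G euclidean_mfd L" and gh: "(g, h) \<in> composable \<Gamma>"
  shows "discrete_EL \<Gamma> L g h \<longleftrightarrow> cot_tgt \<Gamma> (d_section G L g) = cot_src \<Gamma> (d_section G L h)"
proof -
  from gh have g: "g \<in> pts G" and h: "h \<in> pts G" and x: "tgt \<Gamma> g = src \<Gamma> h"
    by (auto simp: composable_def)
  let ?A = "algebroid_fibre \<Gamma> (src \<Gamma> h)"
  let ?f = "\<lambda>k. (L \<circ> ltrans \<Gamma> g) k + (L \<circ> rtrans \<Gamma> h \<circ> inver \<Gamma>) k"
  let ?\<mu> = "snd (cot_tgt \<Gamma> (d_section G L g))" and ?\<nu> = "snd (cot_src \<Gamma> (d_section G L h))"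
  have "differential_on G (src_fibre \<Gamma> (src \<Gamma> h)) ?f (e (src \<Gamma> h)) X = ?\<mu> X - ?\<nu> X" if X: "X \<in> ?A" for X
  proof -
    obtain \<gamma> where \<gamma>: "curve_at G (src_fibre \<Gamma> (src \<Gamma> h)) (e (src \<Gamma> h)) \<gamma>" "velocity G \<gamma> = X"
      by (rule algebroid_fibre_curve[OF src_in[OF h] X])
    have vd: "vector_derivative (\<lambda>t. ?f (\<eta> t)) (at 0) = ?\<mu> X - ?\<nu> X"
      if \<eta>: "curve_at G (src_fibre \<Gamma> (src \<Gamma> h)) (e (src \<Gamma> h)) \<eta>" "velocity G \<eta> = X" for \<eta>
    proof -
      have "((\<lambda>t. L (m g (\<eta> t))) has_vector_derivative ?\<mu> X) (at 0)"
        using cot_tgt_d_section[OF L g, unfolded x, OF \<eta>(1)] X \<eta>(2) by simp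
      moreover have "((\<lambda>t. L (m (inver \<Gamma> (\<eta> t)) h)) has_vector_derivative - ?\<nu> X) (at 0)"
        using cot_src_d_section[OF L h \<eta>(1)] X \<eta>(2) by simp
      ultimately have "((\<lambda>t. L (m g (\<eta> t)) + L (m (inver \<Gamma> (\<eta> t)) h)) has_vector_derivative
          (?\<mu> X + - ?\<nu> X)) (at 0)"
        by (rule has_vector_derivative_add)
      from vector_derivative_at[OF this] show ?thesis
        by (simp add: ltrans_def rtrans_def)
    qed
    have "differential_on G (src_fibre \<Gamma> (src \<Gamma> h)) ?f (e (src \<Gamma> h)) (velocity G \<gamma>) =
        vector_derivative (\<lambda>t. ?f (\<gamma> t)) (at 0)"
    proof (rule differential_on_velocity[OF \<gamma>(1)])
      fix \<eta> assume "curve_at G (src_fibre \<Gamma> (src \<Gamma> h)) (e (src \<Gamma> h)) \<eta>" "velocity G \<eta> = velocity G \<gamma>"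
      then have "vector_derivative (\<lambda>t. ?f (\<eta> t)) (at 0) = ?\<mu> X - ?\<nu> X"
        unfolding \<gamma>(2) by (rule vd)
      then show "vector_derivative (\<lambda>t. ?f (\<eta> t)) (at 0) = vector_derivative (\<lambda>t. ?f (\<gamma> t)) (at 0)"
        unfolding vd[OF \<gamma>] .
    qed
    then show ?thesis unfolding vd[OF \<gamma>] \<gamma>(2) .
  qed
  then have "discrete_EL \<Gamma> L g h \<longleftrightarrow> (\<forall>X\<in>?A. ?\<mu> X = ?\<nu> X)"
    by (simp add: discrete_EL_def Let_def x)
  also have "\<dots> \<longleftrightarrow> ?\<mu> = ?\<nu>"
  proof -
    have "?\<mu> \<in> extensional ?A" "?\<nu> \<in> extensional ?A"
      by (auto simp: cot_tgt_def cot_src_def d_section_def x)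
    then show ?thesis by (metis extensionalityI)
  qed
  also have "\<dots> \<longleftrightarrow> cot_tgt \<Gamma> (d_section G L g) = cot_src \<Gamma> (d_section G L h)"
    by (simp add: cot_tgt_def cot_src_def d_section_def x)
  finally show ?thesis .
qed

end

theorem proposition4p1:
  fixes \<Gamma> :: "('g, 'e::euclidean_space, 'm, 'f::euclidean_space) groupoid"
    and L :: "'g \<Rightarrow> real"
  assumes "lie_groupoid \<Gamma>"
    and "smooth_map (arrows \<Gamma>) euclidean_mfd L"
  shows "lagrangian_forward_step \<Gamma> L =
      {d_section (arrows \<Gamma>) L g | g.
         g \<in> pts (arrows \<Gamma>) \<and> (\<exists>h\<in>pts (arrows \<Gamma>). (g, h) \<in> composable \<Gamma> \<and> discrete_EL \<Gamma> L g h)} \<and>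
    {(g, h) \<in> composable \<Gamma>. discrete_EL \<Gamma> L g h} =
      {(g, h) \<in> composable \<Gamma>.
         cot_tgt \<Gamma> (d_section (arrows \<Gamma>) L g) = cot_src \<Gamma> (d_section (arrows \<Gamma>) L h)} \<and>
    lagrangian_forward_step \<Gamma> L =
      {d_section (arrows \<Gamma>) L g | g.
         g \<in> pts (arrows \<Gamma>) \<and>
         (\<exists>h\<in>pts (arrows \<Gamma>). (g, h) \<in> {(g, h) \<in> composable \<Gamma>.
            cot_tgt \<Gamma> (d_section (arrows \<Gamma>) L g) = cot_src \<Gamma> (d_section (arrows \<Gamma>) L h)})}"
proof -
  interpret Lie_groupoid \<Gamma> by unfold_locales (fact assms(1))
  have in_T: "d_section G L g \<in> cotangent_bundle G" if "g \<in> pts G" for g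
    by (rule d_section_in_cotangent_bundle[OF G_manifold assms(2) that])
  have comp: "(g, h) \<in> composable \<Gamma>"
    if "g \<in> pts G" "h \<in> pts G" "cot_tgt \<Gamma> (d_section G L g) = cot_src \<Gamma> (d_section G L h)" for g h
    using that by (simp add: composable_def cot_tgt_def cot_src_def d_section_def)
  have step: "lagrangian_forward_step \<Gamma> L =
      {d_section G L g | g. g \<in> pts G \<and>
         (\<exists>h\<in>pts G. cot_tgt \<Gamma> (d_section G L g) = cot_src \<Gamma> (d_section G L h))}"
    unfolding lagrangian_forward_step_def forward_step_def lagrangian_eqn_def using in_T by blast
  have EL: "(g, h) \<in> composable \<Gamma> \<and> discrete_EL \<Gamma> L g h \<longleftrightarrow>
      cot_tgt \<Gamma> (d_section G L g) = cot_src \<Gamma> (d_section G L h)" if "g \<in> pts G" "h \<in> pts G" for g h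
    using discrete_EL_iff[OF assms(2)] comp[OF that] by blast
  have "{(g, h) \<in> composable \<Gamma>. discrete_EL \<Gamma> L g h} =
      {(g, h) \<in> composable \<Gamma>. cot_tgt \<Gamma> (d_section G L g) = cot_src \<Gamma> (d_section G L h)}"
    using discrete_EL_iff[OF assms(2)] by auto
  moreover have "lagrangian_forward_step \<Gamma> L =
      {d_section G L g | g. g \<in> pts G \<and> (\<exists>h\<in>pts G. (g, h) \<in> composable \<Gamma> \<and> discrete_EL \<Gamma> L g h)}"
    unfolding step using EL by blast
  moreover have "lagrangian_forward_step \<Gamma> L =
      {d_section G L g | g. g \<in> pts G \<and> (\<exists>h\<in>pts G. (g, h) \<in> {(g, h) \<in> composable \<Gamma>.
            cot_tgt \<Gamma> (d_section G L g) = cot_src \<Gamma> (d_section G L h)})}"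
    unfolding step using comp by blast
  ultimately show ?thesis by blast
qed

end
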